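(* Let $m,p,n\geq1$, $T>0$, and let $\mathcal{X}_1,\dots,\mathcal{X}_n\in\mathbb{C}^{m\times m\times p}$ be independent random Hermitian T-product tensors such that almost surely $\mathcal{X}_i\succeq\mathcal{O}$ and $\lambda_{\max}(\mathcal{X}_i)\leq T$. Define $\mu_{\max}=\lambda_{\max}\left(\sum_{i=1}^n\mathbb{E}\mathcal{X}_i\right)$ and $\mu_{\min}=\lambda_{\min}\left(\sum_{i=1}^n\mathbb{E}\mathcal{X}_i\right)$. Then $$\Pr\left(\lambda_{\max}\left(\sum_{i=1}^n\mathcal{X}_i\right)\geq(1+\theta)\mu_{\max}\right)\leq mp\left(\frac{e^{\theta}}{(1+\theta)^{1+\theta}}\right)^{\mu_{\max}/T}\quad\text{for }\theta\geq0,$$ and $$\Pr\left(\lambda_{\min}\left(\sum_{i=1}^n\mathcal{X}_i\right)\leq(1-\theta)\mu_{\min}\right)\leq mp\left(\frac{e^{-\theta}}{(1-\theta)^{1-\theta}}\right)^{\mu_{\min}/T}\quad\text{for }\theta\in[0,1].$$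
   Context: For $\mathcal{A}\in\mathbb{C}^{m\times n\times p}$ with frontal slices $A^{(1)},\dots,A^{(p)}$, $\mathrm{bcirc}(\mathcal{A})\in\mathbb{C}^{mp\times np}$ is the block circulant matrix whose $(r,s)$ block is $A^{(((r-s)\bmod p)+1)}$. The conjugate transpose $\mathcal{A}^{\mathrm H}$ is obtained by conjugate-transposing every frontal slice and reversing the order of slices $2,\dots,p$, so $\mathrm{bcirc}(\mathcal{A}^{\mathrm H})=\mathrm{bcirc}(\mathcal{A})^{\mathrm H}$. $\mathcal{A}\in\mathbb{C}^{m\times m\times p}$ is Hermitian if $\mathcal{A}^{\mathrm H}=\mathcal{A}$; its eigenvalues are the $mp$ eigenvalues of $\mathrm{bcirc}(\mathcal{A})$, with largest/smallest $\lambda_{\max}$/$\lambda_{\min}$. For Hermitian $\mathcal{A},\mathcal{B}$, $\mathcal{A}\preceq\mathcal{B}$ means $\mathrm{bcirc}(\mathcal{B}-\mathcal{A})$ is positive semidefinite; $\mathcal{O}$ is the zero tensor. Expectation is entrywise; $0^0=1$. *)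

theory Defs
  imports "HOL-Probability.Probability" "Jordan_Normal_Form.Jordan_Normal_Form"
begin

text \<open>A third-order tensor in C^(m x m x p) is represented as a function on index
 triples (i, j, k), with 0-based indices i < m, j < m and k < p (k = frontal slice
 index). Values outside the index box are irrelevant.\<close>

type_synonym tensor = "nat \<times> nat \<times> nat \<Rightarrow> complex"

definition tensor_idx :: "nat \<Rightarrow> nat \<Rightarrow> nat \<Rightarrow> (nat \<times> nat \<times> nat) set" where
  "tensor_idx m n p = {..<m} \<times> {..<n} \<times> {..<p}"

text \<open>Block circulant matrix of an m x n x p tensor: block (r,s) is slice ((r - s) mod p),
 entry (a,b) of block (r,s) sits at row r*m+a, column s*n+b.\<close>
definition bcirc :: "nat \<Rightarrow> nat \<Rightarrow> nat \<Rightarrow> tensor \<Rightarrow> complex mat" where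
  "bcirc m n p A = mat (m * p) (n * p)
     (\<lambda>(r, c). A (r mod m, c mod n, nat ((int (r div m) - int (c div n)) mod int p)))"

text \<open>Conjugate transpose: conjugate-transpose each slice and reverse slices 2..p.\<close>
definition tconjT :: "nat \<Rightarrow> tensor \<Rightarrow> tensor" where
  "tconjT p A = (\<lambda>(i, j, k). cnj (A (j, i, (p - k) mod p)))"

definition t_hermitian :: "nat \<Rightarrow> nat \<Rightarrow> tensor \<Rightarrow> bool" where
  "t_hermitian m p A \<longleftrightarrow> (\<forall>x \<in> tensor_idx m m p. tconjT p A x = A x)"

definition psd_mat :: "complex mat \<Rightarrow> bool" where
  "psd_mat B \<longleftrightarrow> B \<in> carrier_mat (dim_row B) (dim_row B) \<and>
     (\<forall>v \<in> carrier_vec (dim_row B). 0 \<le> conjugate v \<bullet> (B *\<^sub>v v))"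

definition t_le :: "nat \<Rightarrow> nat \<Rightarrow> tensor \<Rightarrow> tensor \<Rightarrow> bool" where
  "t_le m p A B \<longleftrightarrow> psd_mat (bcirc m m p (\<lambda>x. B x - A x))"

definition t_zero :: tensor where "t_zero = (\<lambda>_. 0)"

text \<open>Largest / smallest eigenvalue of a Hermitian tensor (eigenvalues of bcirc, all real).\<close>
definition lam_max :: "nat \<Rightarrow> nat \<Rightarrow> tensor \<Rightarrow> real" where
  "lam_max m p A = Max {x. eigenvalue (bcirc m m p A) (complex_of_real x)}"

definition lam_min :: "nat \<Rightarrow> nat \<Rightarrow> tensor \<Rightarrow> real" where
  "lam_min m p A = Min {x. eigenvalue (bcirc m m p A) (complex_of_real x)}"

definition t_expect :: "'a measure \<Rightarrow> ('a \<Rightarrow> tensor) \<Rightarrow> tensor" where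
  "t_expect M X = (\<lambda>x. integral\<^sup>L M (\<lambda>\<omega>. X \<omega> x))"

definition rpow :: "real \<Rightarrow> real \<Rightarrow> real" where
  "rpow x y = (if x = 0 \<and> y = 0 then 1 else x powr y)"

end

(*
  The bounds follow from the Laplace transform estimate
    E tr exp (s (Y_1 + ... + Y_n)) <= tr exp ((e^s - 1) (E Y_1 + ... + E Y_n)),   0 <= Y_i <= 1,
  applied to Y_i = bcirc X_i / T, and Markov's inequality with s = ln (1 + theta), resp.
  s = ln (1 - theta) (the limit s -> -oo when theta = 1).  The estimate is obtained by replacing
  one Y_i at a time, with the others frozen in a Hermitian matrix H.  Lieb's concavity theorem is
  used in the form of a supporting functional: for Hermitian H, Q there is a positive linear L with
  L (exp Q) = tr exp (H + Q) and tr exp (H + P) <= L (exp P) for all Hermitian P.  For Q = (e^s - 1) E Y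
    E tr exp (H + s Y) <= E L (exp (s Y)) <= E L (1 + (e^s - 1) Y) = L (1 + Q) <= L (exp Q).
  L is the tangent of the jointly convex relative entropy, which is an integral over s >= 0 of the
  quadratic forms <m, (R_A + s L_M)^-1 m>; each of these is bounded below by its tangent
  2 Re <y, m> - <y, (R_A + s L_M) y>, and in eigenbases everything reduces to finite sums of
  elementary integrals.
*)
theory Submission
  imports Defs "Jordan_Normal_Form.Schur_Decomposition" "HOL-Real_Asymp.Real_Asymp"
begin

section \<open>Orthonormal bases and spectral decompositions\<close>

text \<open>The summands need not commute, so the trace exponential of a sum does not factor, and
  the Golden-Thompson inequality handles only two exponents; Lieb's theorem takes the place of the
  factorization. The functional originates in the Gibbs variational formula: tr exp (H + log A) is
  the maximum over M > 0 of tr M H + tr M - S(M, A), where S(M, A) = tr M (log M - log A). As S is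
  jointly convex and homogeneous of degree 1, its tangent at (M0, A0) has no constant term: S(M, A)
  >= tr M (H + 1) - L(A). Here H + 1 = log M0 - log A0 + 1 is the partial derivative in M at M0 =
  exp (H + log A0), and -L is the one in A. For M = exp (H + log A) the left side is tr M H, which
  leaves tr M <= L(A). Both partial derivatives are read off from explicit integrals, and L is
  linear in the matrix entries, so that an expectation passes through it entrywise.\<close>

definition ip :: "nat \<Rightarrow> (nat \<Rightarrow> complex) \<Rightarrow> (nat \<Rightarrow> complex) \<Rightarrow> complex" where
  "ip d x y = (\<Sum>k<d. cnj (x k) * y k)"

definition sesq :: "nat \<Rightarrow> (nat \<Rightarrow> nat \<Rightarrow> complex) \<Rightarrow> (nat \<Rightarrow> complex) \<Rightarrow> (nat \<Rightarrow> complex) \<Rightarrow> complex" where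
  "sesq d A x y = (\<Sum>k<d. \<Sum>l<d. cnj (x k) * A k l * y l)"

definition onb :: "nat \<Rightarrow> (nat \<Rightarrow> nat \<Rightarrow> complex) \<Rightarrow> bool" where
  "onb d u \<longleftrightarrow> (\<forall>i<d. \<forall>j<d. ip d (u i) (u j) = (if i = j then 1 else 0))"

definition hermitian_on :: "nat \<Rightarrow> (nat \<Rightarrow> nat \<Rightarrow> complex) \<Rightarrow> bool" where
  "hermitian_on d A \<longleftrightarrow> (\<forall>k<d. \<forall>l<d. A k l = cnj (A l k))"

text \<open>The first index of \<open>u\<close> selects the eigenvector, the second its coordinate.
  Taking \<open>a\<close> real builds Hermitian symmetry (on indices below \<open>d\<close>) into
  the notion.\<close>

definition spec_decomp :: "nat \<Rightarrow> (nat \<Rightarrow> nat \<Rightarrow> complex) \<Rightarrow> (nat \<Rightarrow> real) \<Rightarrow> (nat \<Rightarrow> nat \<Rightarrow> complex) \<Rightarrow> bool" where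
  "spec_decomp d A a u \<longleftrightarrow> onb d u \<and>
     (\<forall>k<d. \<forall>l<d. A k l = (\<Sum>i<d. complex_of_real (a i) * u i k * cnj (u i l)))"

lemma ip_cnj: "cnj (ip d x y) = ip d y x"
  by (simp add: ip_def mult.commute)

lemma ip_self: "ip d x x = complex_of_real (\<Sum>k<d. (cmod (x k))\<^sup>2)"
  unfolding ip_def of_real_sum by (intro sum.cong refl) (metis complex_norm_square mult.commute)

lemma ip_sum_right: "ip d x (\<lambda>k. \<Sum>i\<in>I. c i * y i k) = (\<Sum>i\<in>I. c i * ip d x (y i))"
proof -
  have "ip d x (\<lambda>k. \<Sum>i\<in>I. c i * y i k) = (\<Sum>k<d. \<Sum>i\<in>I. c i * (cnj (x k) * y i k))"
    by (simp add: ip_def sum_distrib_left ac_simps)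
  also have "\<dots> = (\<Sum>i\<in>I. c i * ip d x (y i))"
    by (subst sum.swap) (simp add: ip_def sum_distrib_left)
  finally show ?thesis .
qed

lemma ip_sum_left: "ip d (\<lambda>k. \<Sum>i\<in>I. c i * x i k) y = (\<Sum>i\<in>I. cnj (c i) * ip d (x i) y)"
proof -
  have "ip d (\<lambda>k. \<Sum>i\<in>I. c i * x i k) y = cnj (ip d y (\<lambda>k. \<Sum>i\<in>I. c i * x i k))"
    by (simp add: ip_cnj)
  also have "\<dots> = (\<Sum>i\<in>I. cnj (c i) * ip d (x i) y)"
    unfolding ip_sum_right by (simp add: ip_cnj)
  finally show ?thesis .
qed

text \<open>A left inverse of a square matrix is also a right inverse. This is where it matters that
  there are exactly \<open>d\<close> vectors.\<close>

lemma onb_complete: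
  assumes "onb d u" "k < d" "l < d"
  shows "(\<Sum>i<d. u i k * cnj (u i l)) = (if k = l then 1 else 0)"
proof -
  define U where "U = mat d d (\<lambda>(k, i). u i k)"
  define V where "V = mat d d (\<lambda>(i, l). cnj (u i l))"
  have c: "U \<in> carrier_mat d d" "V \<in> carrier_mat d d" by (auto simp: U_def V_def)
  have "V * U = 1\<^sub>m d"
    using assms(1) c by (intro eq_matI) (auto simp: onb_def ip_def U_def V_def scalar_prod_def atLeast0LessThan)
  from mat_mult_left_right_inverse[OF c(2,1) this] have "(U * V) $$ (k, l) = 1\<^sub>m d $$ (k, l)" by simp
  then show ?thesis using assms(2,3) c by (simp add: U_def V_def scalar_prod_def atLeast0LessThan)
qed

lemma onb_expand:
  assumes "onb d u" "k < d"
  shows "(\<Sum>i<d. ip d (u i) x * u i k) = x k"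
proof -
  have "(\<Sum>i<d. ip d (u i) x * u i k) = (\<Sum>i<d. \<Sum>l<d. x l * (u i k * cnj (u i l)))"
    unfolding ip_def sum_distrib_right by (simp add: ac_simps)
  also have "\<dots> = (\<Sum>l<d. x l * (\<Sum>i<d. u i k * cnj (u i l)))"
    by (subst sum.swap) (simp add: sum_distrib_left)
  also have "\<dots> = (\<Sum>l<d. if k = l then x l else 0)"
    by (intro sum.cong refl) (simp add: onb_complete[OF assms])
  finally show ?thesis using assms by (simp add: sum.delta)
qed

lemma parseval:
  assumes "onb d u"
  shows "(\<Sum>i<d. ip d x (u i) * ip d (u i) y) = ip d x y"
proof -
  have "ip d x y = ip d x (\<lambda>k. \<Sum>i<d. ip d (u i) y * u i k)"
    unfolding ip_def[of d x] by (intro sum.cong refl) (simp add: onb_expand[OF assms])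
  also have "\<dots> = (\<Sum>i<d. ip d (u i) y * ip d x (u i))" by (rule ip_sum_right)
  finally show ?thesis by (simp add: mult.commute)
qed

lemma parseval_norm:
  assumes "onb d u"
  shows "(\<Sum>i<d. (cmod (ip d x (u i)))\<^sup>2) = Re (ip d x x)"
proof -
  have "complex_of_real (\<Sum>i<d. (cmod (ip d x (u i)))\<^sup>2) = (\<Sum>i<d. ip d x (u i) * ip d (u i) x)"
    unfolding of_real_sum by (intro sum.cong refl) (simp add: complex_norm_square[symmetric] flip: ip_cnj[of d x] of_real_power)
  then show ?thesis unfolding parseval[OF assms] by (metis Re_complex_of_real)
qed

lemma spec_sesq:
  assumes "spec_decomp d A a u"
  shows "sesq d A x y = (\<Sum>i<d. complex_of_real (a i) * ip d x (u i) * ip d (u i) y)"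
proof -
  have "sesq d A x y = (\<Sum>k<d. \<Sum>l<d. \<Sum>i<d. complex_of_real (a i) * (cnj (x k) * u i k) * (cnj (u i l) * y l))"
    unfolding sesq_def
  proof (intro sum.cong refl)
    fix k l assume "k \<in> {..<d}" "l \<in> {..<d}"
    then have *: "A k l = (\<Sum>i<d. complex_of_real (a i) * u i k * cnj (u i l))" using assms by (simp add: spec_decomp_def)
    show "cnj (x k) * A k l * y l = (\<Sum>i<d. complex_of_real (a i) * (cnj (x k) * u i k) * (cnj (u i l) * y l))"
      unfolding * by (simp add: sum_distrib_left sum_distrib_right ac_simps)
  qed
  also have "\<dots> = (\<Sum>i<d. \<Sum>k<d. \<Sum>l<d. complex_of_real (a i) * (cnj (x k) * u i k) * (cnj (u i l) * y l))"
    by (subst sum.swap[of _ "{..<d}" "{..<d}"], subst (2) sum.swap, subst sum.swap) (rule sum.cong[OF refl], rule sum.swap)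
  also have "\<dots> = (\<Sum>i<d. complex_of_real (a i) * ip d x (u i) * ip d (u i) y)"
    by (simp add: ip_def sum_distrib_left sum_distrib_right ac_simps)
  finally show ?thesis .
qed

lemma sesq_add: "sesq d (\<lambda>k l. A k l + B k l) x y = sesq d A x y + sesq d B x y"
  by (simp add: sesq_def sum.distrib algebra_simps)

lemma spec_Re_sesq:
  assumes "spec_decomp d A a u"
  shows "Re (sesq d A x x) = (\<Sum>i<d. a i * (cmod (ip d x (u i)))\<^sup>2)"
proof -
  have "sesq d A x x = complex_of_real (\<Sum>i<d. a i * (cmod (ip d x (u i)))\<^sup>2)"
    unfolding spec_sesq[OF assms] of_real_sum
    by (intro sum.cong refl) (simp add: complex_norm_square[symmetric] mult.assoc flip: ip_cnj[of d x] of_real_power)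
  then show ?thesis by simp
qed


section \<open>The spectral theorem for Hermitian matrices, by deflation\<close>

lemma obtain_onb_eigen:
  assumes n: "0 < n"
  obtains w e where "onb n w" "\<And>k. k < n \<Longrightarrow> (\<Sum>l<n. A k l * w 0 l) = e * w 0 k"
proof -
  define B where "B = mat n n (\<lambda>(k, l). A k l :: complex)"
  have B: "B \<in> carrier_mat n n" by (simp add: B_def)
  have "degree (char_poly B) = n" using degree_monic_char_poly[OF B] by simp
  then have "\<not> constant (poly (char_poly B))" using n by (simp add: constant_degree)
  then obtain e where "poly (char_poly B) e = 0" using fundamental_theorem_of_algebra by blast
  then have "eigenvalue B e" using eigenvalue_root_char_poly[OF B] by simp
  then obtain v where v: "v \<in> carrier_vec n" "v \<noteq> 0\<^sub>v n" "B *\<^sub>v v = e \<cdot>\<^sub>v v"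
    using B unfolding eigenvalue_def eigenvector_def by auto
  interpret cof_vec_space n "TYPE(complex)" .
  define b where "b = basis_completion v"
  define ws where "ws = gram_schmidt n b"
  from basis_completion[OF v(1,2), folded b_def]
  have dist_b: "distinct b" and indep: "\<not> lin_dep (set b)" and b: "set b \<subseteq> carrier_vec n"
    and hdb: "hd b = v" and len_b: "length b = n" by auto
  from hdb len_b n obtain vs where bv: "b = v # vs" by (cases b, auto)
  from gram_schmidt_result[OF b dist_b indep refl, folded ws_def]
  have ws: "set ws \<subseteq> carrier_vec n" "corthogonal ws" "length ws = n" by (auto simp: len_b)
  from gram_schmidt_hd[OF v(1), of vs, folded bv] have hdws: "hd ws = v" unfolding ws_def .
  then have ws0: "ws ! 0 = v" using ws(3) n by (metis hd_conv_nth less_numeral_extra(3) list.size(3))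
  define x where "x i k = (ws ! i) $ k" for i k
  have car: "ws ! i \<in> carrier_vec n" if "i < n" for i using ws that by auto
  have ipx: "ip n (x i) (x j) = (ws ! j) \<bullet>c (ws ! i)" if "i < n" "j < n" for i j
    using car[OF that(1)] car[OF that(2)]
    by (simp add: ip_def x_def scalar_prod_def atLeast0LessThan mult.commute)
  have orth: "(ip n (x i) (x j) = 0) = (i \<noteq> j)" if "i < n" "j < n" for i j
    using corthogonalD[OF ws(2), of j i] that ws(3) by (auto simp: ipx)
  \<comment> \<open>Gram-Schmidt has produced orthogonal vectors that are not normalized. Dividing
    by the norms keeps the first one a multiple of \<open>v\<close>, hence an eigenvector.\<close>
  define r where "r i = sqrt (\<Sum>k<n. (cmod (x i k))\<^sup>2)" for i
  have r2: "ip n (x i) (x i) = complex_of_real ((r i)\<^sup>2)" for i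
    by (simp add: r_def ip_self sum_nonneg)
  have rn: "r i \<noteq> 0" if "i < n" for i
    using orth[OF that that] r2[of i] by auto
  define w where "w i k = x i k / complex_of_real (r i)" for i k
  have ipw: "ip n (w i) (w j) = ip n (x i) (x j) / (complex_of_real (r i) * complex_of_real (r j))" for i j
    by (simp add: ip_def w_def sum_divide_distrib)
  have "onb n w"
    unfolding onb_def ipw using orth rn by (auto simp: r2 power2_eq_square)
  moreover have "(\<Sum>l<n. A k l * w 0 l) = e * w 0 k" if k: "k < n" for k
  proof -
    have "(B *\<^sub>v v) $ k = (\<Sum>l<n. A k l * x 0 l)"
      using k v(1) by (simp add: B_def x_def ws0 scalar_prod_def atLeast0LessThan)
    moreover have "(e \<cdot>\<^sub>v v) $ k = e * x 0 k" using k v(1) by (simp add: x_def ws0)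
    ultimately have "(\<Sum>l<n. A k l * x 0 l) = e * x 0 k" using v(3) by simp
    then show ?thesis by (simp add: w_def flip: sum_divide_distrib)
  qed
  ultimately show ?thesis using that by blast
qed

lemma sesq_cnj:
  assumes "hermitian_on n A"
  shows "cnj (sesq n A x y) = sesq n A y x"
proof -
  have "cnj (sesq n A x y) = (\<Sum>k<n. \<Sum>l<n. cnj (y l) * A l k * x k)"
    unfolding sesq_def cnj_sum
  proof (intro sum.cong refl)
    fix k l assume "k \<in> {..<n}" "l \<in> {..<n}"
    then have "A l k = cnj (A k l)" using assms unfolding hermitian_on_def by blast
    then show "cnj (cnj (x k) * A k l * y l) = cnj (y l) * A l k * x k" by (simp only: complex_cnj_mult complex_cnj_cnj ac_simps)
  qed
  also have "\<dots> = sesq n A y x" unfolding sesq_def by (rule sum.swap)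
  finally show ?thesis .
qed

lemma sesq_ip: "sesq n A x y = ip n x (\<lambda>k. \<Sum>l<n. A k l * y l)"
  by (simp add: sesq_def ip_def sum_distrib_left mult.assoc)

lemma sesq_sum_right: "sesq n A x (\<lambda>k. \<Sum>i\<in>I. c i * y i k) = (\<Sum>i\<in>I. c i * sesq n A x (y i))"
proof -
  have "sesq n A x (\<lambda>k. \<Sum>i\<in>I. c i * y i k) = ip n x (\<lambda>k. \<Sum>l<n. \<Sum>i\<in>I. c i * (A k l * y i l))"
    by (simp add: sesq_ip sum_distrib_left ac_simps)
  also have "\<dots> = ip n x (\<lambda>k. \<Sum>i\<in>I. c i * (\<Sum>l<n. A k l * y i l))"
    by (subst sum.swap) (simp add: sum_distrib_left)
  also have "\<dots> = (\<Sum>i\<in>I. c i * sesq n A x (y i))"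
    by (simp add: ip_sum_right sesq_ip)
  finally show ?thesis .
qed

lemma spec_decompI:
  assumes "onb n u" "\<And>i k. i < n \<Longrightarrow> k < n \<Longrightarrow> (\<Sum>l<n. A k l * u i l) = complex_of_real (a i) * u i k"
  shows "spec_decomp n A a u"
  unfolding spec_decomp_def
proof (intro conjI allI impI)
  fix k l assume kl: "k < n" "l < n"
  have "(\<Sum>i<n. complex_of_real (a i) * u i k * cnj (u i l)) = (\<Sum>i<n. (\<Sum>j<n. A k j * u i j) * cnj (u i l))"
    using assms(2) kl by simp
  also have "\<dots> = (\<Sum>j<n. A k j * (\<Sum>i<n. u i j * cnj (u i l)))"
    by (simp add: sum_distrib_left sum_distrib_right mult.assoc) (rule sum.swap)
  also have "\<dots> = (\<Sum>j<n. A k j * (if j = l then 1 else 0))"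
    by (intro sum.cong refl) (simp add: onb_complete[OF assms(1)] kl)
  also have "\<dots> = A k l" using kl by (simp add: if_distrib sum.delta cong: if_cong)
  finally show "A k l = (\<Sum>i<n. complex_of_real (a i) * u i k * cnj (u i l))" ..
qed (fact assms(1))

lemma spec_apply:
  assumes "spec_decomp n A a u" "i < n" "k < n"
  shows "(\<Sum>l<n. A k l * u i l) = complex_of_real (a i) * u i k"
proof -
  have "(\<Sum>l<n. A k l * u i l) = (\<Sum>l<n. \<Sum>j<n. complex_of_real (a j) * u j k * (cnj (u j l) * u i l))"
    using assms by (intro sum.cong refl) (simp add: spec_decomp_def sum_distrib_right mult.assoc)
  also have "\<dots> = (\<Sum>j<n. complex_of_real (a j) * u j k * ip n (u j) (u i))"
    by (subst sum.swap) (simp add: ip_def sum_distrib_left)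
  also have "\<dots> = (\<Sum>j<n. if j = i then complex_of_real (a j) * u j k else 0)"
    using assms by (intro sum.cong refl) (auto simp: spec_decomp_def onb_def)
  finally show ?thesis using assms by (simp add: sum.delta)
qed

lemma ip_ext:
  assumes "onb n w" "\<And>i. i < n \<Longrightarrow> ip n (w i) x = ip n (w i) y" "k < n"
  shows "x k = y k"
  using onb_expand[OF assms(1,3), of x] onb_expand[OF assms(1,3), of y] assms(2) by simp

lemma onb_coeff:
  assumes "onb d w" "j < d"
  shows "ip d (w j) (\<lambda>k. \<Sum>i<d. a i * w i k) = a j"
proof -
  have "ip d (w j) (\<lambda>k. \<Sum>i<d. a i * w i k) = (\<Sum>i<d. if j = i then a i else 0)"
    unfolding ip_sum_right using assms by (intro sum.cong refl) (auto simp: onb_def)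
  then show ?thesis using assms by simp
qed

theorem spectral:
  assumes "hermitian_on n A"
  shows "\<exists>a u. spec_decomp n A a u"
  using assms
proof (induction n arbitrary: A)
  case 0
  then show ?case by (simp add: spec_decomp_def onb_def)
next
  case (Suc n)
  note sum.lessThan_Suc [simp del]
  obtain w e where w: "onb (Suc n) w" "\<And>k. k < Suc n \<Longrightarrow> (\<Sum>l<Suc n. A k l * w 0 l) = e * w 0 k"
    using obtain_onb_eigen[of "Suc n" A] by auto
  \<comment> \<open>The compression of \<open>A\<close> to the orthogonal complement of the
    eigenvector \<open>w 0\<close>; the shift by \<open>Suc\<close> skips that vector.\<close>
  define B where "B i j = sesq (Suc n) A (w (Suc i)) (w (Suc j))" for i j
  have "hermitian_on n B"
    unfolding hermitian_on_def B_def by (simp add: sesq_cnj[OF Suc.prems])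
  then obtain b z where z: "spec_decomp n B b z" using Suc.IH by blast
  have A0: "sesq (Suc n) A x (w 0) = e * ip (Suc n) x (w 0)" for x
  proof -
    have "sesq (Suc n) A x (w 0) = (\<Sum>k<Suc n. cnj (x k) * (e * w 0 k))"
      unfolding sesq_ip ip_def using w(2) by (intro sum.cong refl) simp
    then show ?thesis by (simp add: ip_def sum_distrib_left ac_simps)
  qed
  have ipw: "ip (Suc n) (w i) (w j) = (if i = j then 1 else 0)" if "i < Suc n" "j < Suc n" for i j
    using w(1) that by (simp add: onb_def)
  have e_real: "e = complex_of_real (Re e)"
  proof -
    have "sesq (Suc n) A (w 0) (w 0) = e" using A0 ipw[of 0 0] by simp
    then have "cnj e = e" using sesq_cnj[OF Suc.prems, of "w 0" "w 0"] by simp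
    then show ?thesis by (metis Reals_cnj_iff of_real_Re)
  qed
  \<comment> \<open>Eigenvectors of the compression are read as coordinates with respect to
    \<open>w (Suc i)\<close> and so return to the full space.\<close>
  define y where "y m = (\<lambda>k. \<Sum>i<n. z m i * w (Suc i) k)" for m
  define u where "u m = (case m of 0 \<Rightarrow> w 0 | Suc m \<Rightarrow> y m)" for m
  define a where "a m = (case m of 0 \<Rightarrow> Re e | Suc m \<Rightarrow> b m)" for m
  have ip_wy: "ip (Suc n) (w (Suc i)) (y m) = z m i" if "i < n" for i m
  proof -
    have "ip (Suc n) (w (Suc i)) (y m) = (\<Sum>j<n. if i = j then z m j else 0)"
      unfolding y_def ip_sum_right using that by (intro sum.cong refl) (auto simp: ipw)
    then show ?thesis using that by simp
  qed
  have ip_0y: "ip (Suc n) (w 0) (y m) = 0" for m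
    unfolding y_def ip_sum_right by (intro sum.neutral) (auto simp: ipw)
  have ip_yy: "ip (Suc n) (y i) (y j) = ip n (z i) (z j)" for i j
    unfolding y_def[of i] ip_sum_left ip_def[of n] by (intro sum.cong refl) (simp add: ip_wy)
  have onb_u: "onb (Suc n) u"
    unfolding onb_def
  proof (intro allI impI)
    fix i j assume ij: "i < Suc n" "j < Suc n"
    have "ip (Suc n) (y m) (w 0) = 0" for m using ip_0y[of m] ip_cnj[of "Suc n" "w 0" "y m"] by simp
    then show "ip (Suc n) (u i) (u j) = (if i = j then 1 else 0)"
      using ij z by (auto simp: u_def ip_0y ip_yy ipw spec_decomp_def onb_def split: nat.splits)
  qed
  have "(\<Sum>l<Suc n. A k l * u m l) = complex_of_real (a m) * u m k" if m: "m < Suc n" and k: "k < Suc n" for m k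
  proof (cases m)
    case 0
    then show ?thesis using w(2)[OF k] e_real by (simp add: u_def a_def)
  next
    case (Suc q)
    then have q: "q < n" using m by simp
    \<comment> \<open>Coefficients in the basis \<open>w\<close> are compared. The one at index 0
      vanishes because a Hermitian \<open>A\<close> maps the complement of \<open>w 0\<close> into
      itself; the others form the eigenvalue equation of \<open>B\<close>.\<close>
    have "ip (Suc n) (w i) (\<lambda>k. \<Sum>l<Suc n. A k l * y q l) = ip (Suc n) (w i) (\<lambda>k. complex_of_real (b q) * y q k)"
      if i: "i < Suc n" for i
    proof (cases i)
      case 0
      have "sesq (Suc n) A (w 0) (y q) = cnj (sesq (Suc n) A (y q) (w 0))"
        by (simp add: sesq_cnj[OF Suc.prems])
      also have "\<dots> = 0" unfolding A0 by (simp add: ip_cnj ip_0y)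
      finally have "ip (Suc n) (w 0) (\<lambda>k. \<Sum>l<Suc n. A k l * y q l) = 0" by (simp add: sesq_ip)
      moreover have "ip (Suc n) (w 0) (\<lambda>k. complex_of_real (b q) * y q k) = complex_of_real (b q) * ip (Suc n) (w 0) (y q)"
        using ip_sum_right[of "Suc n" "w 0" "\<lambda>_. complex_of_real (b q)" "\<lambda>_. y q" "{0::nat}"] by simp
      ultimately show ?thesis using 0 ip_0y by simp
    next
      case (Suc i')
      then have i': "i' < n" using i by simp
      have "sesq (Suc n) A (w i) (y q) = (\<Sum>j<n. B i' j * z q j)"
        unfolding y_def sesq_sum_right by (simp add: B_def Suc mult.commute)
      also have "\<dots> = complex_of_real (b q) * z q i'" using spec_apply[OF z q i'] .
      finally have "ip (Suc n) (w i) (\<lambda>k. \<Sum>l<Suc n. A k l * y q l) = complex_of_real (b q) * z q i'" by (simp add: sesq_ip)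
      moreover have "ip (Suc n) (w i) (\<lambda>k. complex_of_real (b q) * y q k) = complex_of_real (b q) * ip (Suc n) (w i) (y q)"
        using ip_sum_right[of "Suc n" "w i" "\<lambda>_. complex_of_real (b q)" "\<lambda>_. y q" "{0::nat}"] by simp
      ultimately show ?thesis using ip_wy[OF i'] Suc by simp
    qed
    from ip_ext[OF w(1) this k] show ?thesis by (simp add: Suc u_def a_def)
  qed
  then show ?case using spec_decompI[OF onb_u, of A a] by blast
qed


section \<open>The trace exponential\<close>

primrec mpow :: "nat \<Rightarrow> (nat \<Rightarrow> nat \<Rightarrow> complex) \<Rightarrow> nat \<Rightarrow> nat \<Rightarrow> nat \<Rightarrow> complex" where
  "mpow d A 0 = (\<lambda>k l. if k = l then 1 else 0)"
| "mpow d A (Suc n) = (\<lambda>k l. \<Sum>r<d. A k r * mpow d A n r l)"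

text \<open>The power series, rather than a sum over eigenvalues, makes measurability in the matrix
  entries immediate; on Hermitian matrices both agree (lemma \<open>trexp_eq\<close>).\<close>
definition trexp :: "nat \<Rightarrow> (nat \<Rightarrow> nat \<Rightarrow> complex) \<Rightarrow> real" where
  "trexp d A = lim (\<lambda>N. \<Sum>n<N. Re (\<Sum>k<d. mpow d A n k k) / fact n)"

lemma spec_mpow:
  assumes "spec_decomp d A a u" "k < d" "l < d"
  shows "mpow d A n k l = (\<Sum>i<d. complex_of_real (a i ^ n) * u i k * cnj (u i l))"
  using assms(2)
proof (induction n arbitrary: k)
  case 0
  then show ?case using onb_complete[of d u k l] assms by (simp add: spec_decomp_def)
next
  case (Suc n)
  have "mpow d A (Suc n) k l = (\<Sum>r<d. \<Sum>i<d. complex_of_real (a i ^ n) * cnj (u i l) * (A k r * u i r))"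
    using Suc by (simp add: sum_distrib_left ac_simps)
  also have "\<dots> = (\<Sum>i<d. complex_of_real (a i ^ n) * cnj (u i l) * (\<Sum>r<d. A k r * u i r))"
    by (subst sum.swap) (simp add: sum_distrib_left)
  also have "\<dots> = (\<Sum>i<d. complex_of_real (a i ^ Suc n) * u i k * cnj (u i l))"
    by (intro sum.cong refl) (use Suc.prems in \<open>simp add: spec_apply[OF assms(1)] ac_simps\<close>)
  finally show ?case .
qed

lemma spec_trace_mpow:
  assumes "spec_decomp d A a u"
  shows "Re (\<Sum>k<d. mpow d A n k k) = (\<Sum>i<d. a i ^ n)"
proof -
  have "(\<Sum>k<d. mpow d A n k k) = (\<Sum>k<d. \<Sum>i<d. complex_of_real (a i ^ n) * (cnj (u i k) * u i k))"
    by (intro sum.cong refl) (simp add: spec_mpow[OF assms] ac_simps)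
  also have "\<dots> = (\<Sum>i<d. complex_of_real (a i ^ n) * ip d (u i) (u i))"
    by (subst sum.swap) (simp add: sum_distrib_left ip_def)
  also have "\<dots> = (\<Sum>i<d. complex_of_real (a i ^ n))"
    using assms by (simp add: spec_decomp_def onb_def)
  finally show ?thesis by (simp del: of_real_power)
qed

lemma trexp_eq:
  assumes "spec_decomp d A a u"
  shows "trexp d A = (\<Sum>i<d. exp (a i))"
proof -
  have "(\<lambda>n. \<Sum>i<d. a i ^ n / fact n) sums (\<Sum>i<d. exp (a i))"
    by (intro sums_sum) (use exp_converges[where 'a = real] in \<open>simp add: divide_inverse mult.commute\<close>)
  then have "(\<lambda>N. \<Sum>n<N. Re (\<Sum>k<d. mpow d A n k k) / fact n) \<longlonglongrightarrow> (\<Sum>i<d. exp (a i))"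
    unfolding sums_def spec_trace_mpow[OF assms] by (simp only: sum_divide_distrib)
  then show ?thesis unfolding trexp_def by (rule limI)
qed

lemma trexp_measurable:
  assumes "\<And>k l. k < d \<Longrightarrow> l < d \<Longrightarrow> (\<lambda>x. A x k l) \<in> borel_measurable M"
  shows "(\<lambda>x. trexp d (A x)) \<in> borel_measurable M"
proof -
  have "(\<lambda>x. mpow d (A x) n k l) \<in> borel_measurable M" if "k < d" for n k l
    using that
    by (induction n arbitrary: k) (auto intro!: borel_measurable_sum borel_measurable_times assms)
  then show ?thesis unfolding trexp_def
    by (intro borel_measurable_lim_metric borel_measurable_sum borel_measurable_divide borel_measurable_const
        measurable_compose[OF _ borel_measurable_Re]) auto
qed

lemma trexp_nonneg:
  assumes "hermitian_on d A"
  shows "trexp d A \<ge> 0"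
  using spectral[OF assms] trexp_eq by (metis exp_ge_zero sum_nonneg)

text \<open>An eigenvector has a nonzero coefficient along some \<open>u i\<close>, and pairing the
  eigenvalue equation with that \<open>u i\<close> forces the eigenvalue to be \<open>a i\<close>.
  Multiplicities are lost, which does not affect \<open>Max\<close> and \<open>Min\<close>.\<close>

lemma spec_eigenvalue:
  assumes "spec_decomp d A a u" and B: "B = mat d d (\<lambda>(k, l). A k l)"
  shows "{x. eigenvalue B (complex_of_real x)} = a ` {..<d}"
proof (intro equalityI subsetI)
  fix x assume "x \<in> {x. eigenvalue B (complex_of_real x)}"
  then obtain v where v: "v \<in> carrier_vec d" "v \<noteq> 0\<^sub>v d" "B *\<^sub>v v = complex_of_real x \<cdot>\<^sub>v v"
    using B unfolding eigenvalue_def eigenvector_def by auto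
  define y where "y = (\<lambda>k. v $ k)"
  have Ay: "(\<Sum>l<d. A k l * y l) = complex_of_real x * y k" if k: "k < d" for k
  proof -
    have "(B *\<^sub>v v) $ k = (\<Sum>l<d. A k l * y l)"
      using k v(1) B by (simp add: y_def scalar_prod_def atLeast0LessThan)
    then show ?thesis using k v by (simp add: y_def)
  qed
  have onb: "onb d u" using assms(1) by (simp add: spec_decomp_def)
  have "complex_of_real (a i) * ip d (u i) y = complex_of_real x * ip d (u i) y" if i: "i < d" for i
  proof -
    have "sesq d A (u i) y = (\<Sum>k<d. cnj (u i k) * (complex_of_real x * y k))"
      unfolding sesq_ip ip_def using Ay by (intro sum.cong refl) simp
    then have "sesq d A (u i) y = complex_of_real x * ip d (u i) y"
      by (simp add: ip_def sum_distrib_left ac_simps)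
    moreover have "sesq d A (u i) y = (\<Sum>j<d. if j = i then complex_of_real (a j) * ip d (u j) y else 0)"
      unfolding spec_sesq[OF assms(1)] using onb i by (intro sum.cong refl) (auto simp: onb_def)
    ultimately show ?thesis using i by simp
  qed
  moreover have "\<exists>i<d. ip d (u i) y \<noteq> 0"
  proof (rule ccontr)
    assume "\<not> ?thesis"
    then have "y k = 0" if "k < d" for k using onb_expand[OF onb that, of y] by simp
    then show False using v(1,2) by (auto simp: y_def)
  qed
  ultimately show "x \<in> a ` {..<d}" by auto
next
  fix x assume "x \<in> a ` {..<d}"
  then obtain i where i: "i < d" "x = a i" by auto
  define v where "v = vec d (u i)"
  have "v \<noteq> 0\<^sub>v d"
  proof
    assume "v = 0\<^sub>v d"
    then have "u i k = 0" if "k < d" for k using that by (metis v_def index_vec index_zero_vec(1))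
    then have "ip d (u i) (u i) = 0" by (simp add: ip_def)
    then show False using assms(1) i by (simp add: spec_decomp_def onb_def)
  qed
  moreover have "B *\<^sub>v v = complex_of_real x \<cdot>\<^sub>v v"
    using B spec_apply[OF assms(1) i(1)] i(2)
    by (intro eq_vecI) (auto simp: v_def scalar_prod_def atLeast0LessThan)
  ultimately show "x \<in> {x. eigenvalue B (complex_of_real x)}"
    using B unfolding eigenvalue_def eigenvector_def by (auto intro!: exI[of _ v] simp: v_def)
qed

section \<open>Improper integrals of rational functions\<close>

text \<open>A limit of integrals over bounded intervals suits integrands with explicit
  antiderivatives, whose separate terms, such as 1 / (1 + s), diverge at infinity and converge only
  in combination.\<close>

definition improper :: "(real \<Rightarrow> real) \<Rightarrow> real \<Rightarrow> bool" where
  "improper \<phi> l \<longleftrightarrow> (\<forall>R. \<phi> integrable_on {0..R}) \<and> ((\<lambda>R. integral {0..R} \<phi>) \<longlongrightarrow> l) at_top"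

lemma improper_FTC:
  assumes "\<And>s. s \<ge> 0 \<Longrightarrow> (F has_real_derivative \<phi> s) (at s)" "(F \<longlongrightarrow> L) at_top" "l = L - F 0"
  shows "improper \<phi> l"
proof -
  have *: "(\<phi> has_integral (F R - F 0)) {0..R}" if "R \<ge> 0" for R
    using that assms(1) by (intro fundamental_theorem_of_calculus)
      (auto simp flip: has_real_derivative_iff_has_vector_derivative intro: DERIV_subset)
  have "\<phi> integrable_on {0..R}" for R
  proof (cases "R \<ge> 0")
    case True then show ?thesis using * by blast
  qed auto
  moreover have "eventually (\<lambda>R. F R - F 0 = integral {0..R} \<phi>) at_top"
    using eventually_ge_at_top[of 0] by eventually_elim (simp add: integral_unique[OF *])
  then have "((\<lambda>R. integral {0..R} \<phi>) \<longlongrightarrow> L - F 0) at_top"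
    by (rule Lim_transform_eventually[rotated]) (intro tendsto_intros assms)
  ultimately show ?thesis by (simp add: improper_def assms(3))
qed

lemma improper_sum:
  assumes "finite I" "\<And>i. i \<in> I \<Longrightarrow> improper (\<phi> i) (l i)"
  shows "improper (\<lambda>s. \<Sum>i\<in>I. \<phi> i s) (\<Sum>i\<in>I. l i)"
proof -
  have "(\<lambda>s. \<Sum>i\<in>I. \<phi> i s) integrable_on {0..R}" for R
    using assms by (intro integrable_sum) (auto simp: improper_def)
  moreover have "integral {0..R} (\<lambda>s. \<Sum>i\<in>I. \<phi> i s) = (\<Sum>i\<in>I. integral {0..R} (\<phi> i))" for R
    using assms by (intro integral_sum) (auto simp: improper_def)
  ultimately show ?thesis using assms by (auto simp: improper_def intro!: tendsto_sum)
qed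

lemma improper_cmult: "improper \<phi> l \<Longrightarrow> improper (\<lambda>s. c * \<phi> s) (c * l)"
  by (auto simp: improper_def intro!: tendsto_mult integrable_on_mult_right)

lemma improper_diff: "improper \<phi> l \<Longrightarrow> improper \<psi> m \<Longrightarrow> improper (\<lambda>s. \<phi> s - \<psi> s) (l - m)"
  by (auto simp: improper_def integral_diff intro!: tendsto_diff integrable_diff)

lemma improper_le:
  assumes "improper \<phi> l" "improper \<psi> m" "\<And>s. s \<ge> 0 \<Longrightarrow> \<phi> s \<le> \<psi> s"
  shows "l \<le> m"
proof (rule tendsto_le[OF trivial_limit_at_top_linorder])
  show "((\<lambda>R. integral {0..R} \<phi>) \<longlongrightarrow> l) at_top" "((\<lambda>R. integral {0..R} \<psi>) \<longlongrightarrow> m) at_top"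
    using assms by (auto simp: improper_def)
  show "\<forall>\<^sub>F R in at_top. integral {0..R} \<phi> \<le> integral {0..R} \<psi>"
    using assms by (intro always_eventually allI integral_le) (auto simp: improper_def)
qed

lemma improper_nonneg:
  assumes "improper \<phi> l" "\<And>s. s \<ge> 0 \<Longrightarrow> 0 \<le> \<phi> s"
  shows "0 \<le> l"
  using improper_le[OF improper_cmult[OF assms(1), of 0] assms(1)] assms(2) by simp

text \<open>The scalar case of the integral for tr M (log M - log A): the quadratic form contributes
  the first fraction, and the second removes its divergence at infinity.\<close>

lemma improper_log:
  assumes "\<mu> > 0" "\<alpha> > 0"
  shows "improper (\<lambda>s. \<mu>\<^sup>2 / (\<alpha> + s * \<mu>) - \<mu> / (1 + s)) (\<mu> * (ln \<mu> - ln \<alpha>))"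
proof (rule improper_FTC[where F = "\<lambda>s. \<mu> * (ln (\<alpha> + s * \<mu>) - ln (1 + s))" and L = "\<mu> * ln \<mu>"])
  fix s :: real assume "s \<ge> 0"
  then have "\<alpha> + s * \<mu> > 0" using assms by (simp add: add_pos_nonneg)
  then show "((\<lambda>s. \<mu> * (ln (\<alpha> + s * \<mu>) - ln (1 + s))) has_real_derivative \<mu>\<^sup>2 / (\<alpha> + s * \<mu>) - \<mu> / (1 + s)) (at s)"
    using \<open>s \<ge> 0\<close> by (auto intro!: derivative_eq_intros simp: field_simps power2_eq_square)
next
  show "((\<lambda>s. \<mu> * (ln (\<alpha> + s * \<mu>) - ln (1 + s))) \<longlongrightarrow> \<mu> * ln \<mu>) at_top"
    using assms by real_asymp
qed (simp add: algebra_simps)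

section \<open>Integrals behind the two partial derivatives of the relative entropy\<close>

lemma DERIV_ln_affine:
  "b + s * x > 0 \<Longrightarrow> ((\<lambda>s. ln (b + s * x)) has_real_derivative x / (b + s * x)) (at s)"
  by (auto intro!: derivative_eq_intros)

lemma DERIV_ln_1: "s \<ge> 0 \<Longrightarrow> ((\<lambda>s. ln (1 + s)) has_real_derivative 1 / (1 + s)) (at s)"
  using DERIV_ln_affine[of 1 s 1] by simp

text \<open>This is \<open>m\<close> divided by the logarithmic mean of \<open>a\<close> and
  \<open>a'\<close>, equivalently \<open>m\<close> times the divided difference of ln, which
  represents the derivative of the matrix logarithm in an eigenbasis.\<close>

definition invlogmean :: "real \<Rightarrow> real \<Rightarrow> real \<Rightarrow> real" where
  "invlogmean m a a' = (if a = a' then m / a else m * (ln a' - ln a) / (a' - a))"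

text \<open>The integrand is minus the divided difference at \<open>a\<close>, \<open>a'\<close> of
  \<open>m\<^sup>2 / (x + s * m)\<close>, so the value is minus that of m (ln m - ln x), in
  agreement with \<open>improper_log\<close>.\<close>

lemma improper_invlogmean:
  assumes "m > 0" "a > 0" "a' > 0"
  shows "improper (\<lambda>s. m / (a + s * m) * (m / (a' + s * m))) (invlogmean m a a')"
proof (cases "a = a'")
  case True
  show ?thesis
  proof (rule improper_FTC[where F = "\<lambda>s. - m / (a + s * m)" and L = 0])
    fix s :: real assume "s \<ge> 0"
    then have "a + s * m > 0" using assms by (simp add: add_pos_nonneg)
    then show "((\<lambda>s. - m / (a + s * m)) has_real_derivative m / (a + s * m) * (m / (a' + s * m))) (at s)"
      using True by (auto intro!: derivative_eq_intros simp: field_simps power2_eq_square)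
  next
    show "((\<lambda>s. - m / (a + s * m)) \<longlongrightarrow> 0) at_top" using assms by real_asymp
  qed (use True in \<open>simp add: invlogmean_def\<close>)
next
  case False
  show ?thesis
  proof (rule improper_FTC[where F = "\<lambda>s. m / (a' - a) * (ln (a + s * m) - ln (a' + s * m))" and L = 0])
    fix s :: real assume "s \<ge> 0"
    then have pos: "a + s * m > 0" "a' + s * m > 0" using assms by (simp_all add: add_pos_nonneg)
    have "((\<lambda>s. m / (a' - a) * (ln (a + s * m) - ln (a' + s * m))) has_real_derivative
        m / (a' - a) * (m / (a + s * m) - m / (a' + s * m))) (at s)"
      by (intro DERIV_cmult DERIV_diff DERIV_ln_affine pos)
    moreover have "m / (a' - a) * (m / (a + s * m) - m / (a' + s * m)) = m / (a + s * m) * (m / (a' + s * m))"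
      using pos False by (simp add: divide_simps) (simp add: algebra_simps)
    ultimately show "((\<lambda>s. m / (a' - a) * (ln (a + s * m) - ln (a' + s * m))) has_real_derivative
        m / (a + s * m) * (m / (a' + s * m))) (at s)" by simp
  next
    show "((\<lambda>s. m / (a' - a) * (ln (a + s * m) - ln (a' + s * m))) \<longlongrightarrow> 0) at_top"
      using assms by real_asymp
  qed (use False in \<open>simp add: invlogmean_def field_simps\<close>)
qed

text \<open>The divided difference of x ln x, continued by the derivative on the diagonal.\<close>

definition xlogx_slope :: "real \<Rightarrow> real \<Rightarrow> real" where
  "xlogx_slope m m' = (if m = m' then ln m + 1 else (m * ln m - m' * ln m') / (m - m'))"

text \<open>As a function of \<open>m\<close> and \<open>m'\<close> this is the divided difference
  of x^2 / (a + s x) - x / (1 + s), the integrand of \<open>improper_log\<close>. Hence it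
  integrates to the divided difference of x (ln x - ln a).\<close>

definition rat_kernel :: "real \<Rightarrow> real \<Rightarrow> real \<Rightarrow> real \<Rightarrow> real" where
  "rat_kernel m m' a s = m / (a + s * m) + m' / (a + s * m') - s * (m / (a + s * m) * (m' / (a + s * m'))) - 1 / (1 + s)"

lemma improper_kern:
  assumes "m > 0" "m' > 0" "a > 0"
  shows "improper (rat_kernel m m' a) (xlogx_slope m m' - ln a)"
proof (cases "m = m'")
  case True
  show ?thesis
  \<comment> \<open>Up to an additive constant, the derivative at x = m of the antiderivative x (ln
    (a + s x) - ln (1 + s)) from \<open>improper_log\<close>; the case of distinct arguments takes
    its difference quotient.\<close>
  proof (rule improper_FTC[where F = "\<lambda>s. ln (a + s * m) - a / (a + s * m) - ln (1 + s)" and L = "ln m"])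
    fix s :: real assume s: "s \<ge> 0"
    then have pos: "a + s * m > 0" using assms by (simp add: add_pos_nonneg)
    have "((\<lambda>s. ln (a + s * m) - a / (a + s * m) - ln (1 + s)) has_real_derivative
        m / (a + s * m) + a * m / (a + s * m)\<^sup>2 - 1 / (1 + s)) (at s)"
      using pos s by (auto intro!: derivative_eq_intros simp: power2_eq_square)
    moreover have "m / (a + s * m) + a * m / (a + s * m)\<^sup>2 - 1 / (1 + s) = rat_kernel m m' a s"
    proof -
      have "a * m / (a + s * m)\<^sup>2 = m / (a + s * m) - s * (m / (a + s * m) * (m / (a + s * m)))"
        using pos by (simp add: divide_simps power2_eq_square) (simp add: algebra_simps)
      then show ?thesis using True by (simp add: rat_kernel_def)
    qed
    ultimately show "((\<lambda>s. ln (a + s * m) - a / (a + s * m) - ln (1 + s)) has_real_derivative rat_kernel m m' a s) (at s)"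
      by simp
  next
    show "((\<lambda>s. ln (a + s * m) - a / (a + s * m) - ln (1 + s)) \<longlongrightarrow> ln m) at_top"
      using assms by real_asymp
  qed (use True assms in \<open>simp add: xlogx_slope_def\<close>)
next
  case False
  show ?thesis
  proof (rule improper_FTC[where F = "\<lambda>s. m / (m - m') * (ln (a + s * m) - ln (1 + s)) - m' / (m - m') * (ln (a + s * m') - ln (1 + s))"
        and L = "m / (m - m') * ln m - m' / (m - m') * ln m'"])
    fix s :: real assume s: "s \<ge> 0"
    then have pos: "a + s * m > 0" "a + s * m' > 0" using assms by (simp_all add: add_pos_nonneg)
    have "((\<lambda>s. m / (m - m') * (ln (a + s * m) - ln (1 + s)) - m' / (m - m') * (ln (a + s * m') - ln (1 + s)))
        has_real_derivative
        m / (m - m') * (m / (a + s * m) - 1 / (1 + s)) - m' / (m - m') * (m' / (a + s * m') - 1 / (1 + s))) (at s)"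
      by (intro DERIV_cmult DERIV_diff DERIV_ln_affine DERIV_ln_1 pos s)
    moreover have "m / (m - m') * (m / (a + s * m) - 1 / (1 + s)) - m' / (m - m') * (m' / (a + s * m') - 1 / (1 + s)) = rat_kernel m m' a s"
    proof -
      have "m / (m - m') * (m / (a + s * m)) - m' / (m - m') * (m' / (a + s * m'))
          = m / (a + s * m) + m' / (a + s * m') - s * (m / (a + s * m) * (m' / (a + s * m')))"
        using pos False by (simp add: divide_simps) (simp add: algebra_simps)
      moreover have "m / (m - m') * x - m' / (m - m') * x = x" for x
        using False by (simp add: divide_simps) (simp add: algebra_simps)
      then have "m / (m - m') * (1 / (1 + s)) - m' / (m - m') * (1 / (1 + s)) = 1 / (1 + s)" .
      ultimately show ?thesis unfolding rat_kernel_def right_diff_distrib by linarith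
    qed
    ultimately show "((\<lambda>s. m / (m - m') * (ln (a + s * m) - ln (1 + s)) - m' / (m - m') * (ln (a + s * m') - ln (1 + s)))
        has_real_derivative rat_kernel m m' a s) (at s)" by simp
  next
    have lim: "((\<lambda>s. ln (a + s * x) - ln (1 + s)) \<longlongrightarrow> ln x) at_top" if "x > 0" for x
      using assms that by real_asymp
    show "((\<lambda>s. m / (m - m') * (ln (a + s * m) - ln (1 + s)) - m' / (m - m') * (ln (a + s * m') - ln (1 + s)))
       \<longlongrightarrow> m / (m - m') * ln m - m' / (m - m') * ln m') at_top"
      by (intro tendsto_intros lim assms)
  next
    show "xlogx_slope m m' - ln a = m / (m - m') * ln m - m' / (m - m') * ln m' -
      (m / (m - m') * (ln (a + 0 * m) - ln (1 + 0)) - m' / (m - m') * (ln (a + 0 * m') - ln (1 + 0)))"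
      using False by (simp add: xlogx_slope_def divide_simps) (simp add: algebra_simps)
  qed
qed

section \<open>The supporting functional in Lieb's concavity theorem\<close>

lemma Re_weighted_sum:
  fixes p :: "'i \<Rightarrow> complex" and r r' :: "'i \<Rightarrow> real"
  shows "Re ((\<Sum>i\<in>I. complex_of_real (r i) * p i) * cnj (\<Sum>i\<in>I. complex_of_real (r' i) * p i)) =
    (\<Sum>i\<in>I. \<Sum>i'\<in>I. Re (p i * cnj (p i')) * (r i * r' i'))"
proof -
  have "(\<Sum>i\<in>I. complex_of_real (r i) * p i) * cnj (\<Sum>i\<in>I. complex_of_real (r' i) * p i) =
    (\<Sum>i\<in>I. \<Sum>i'\<in>I. complex_of_real (r i * r' i') * (p i * cnj (p i')))"
    unfolding cnj_sum sum_product by (intro sum.cong refl) (simp add: ac_simps)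
  then show ?thesis by (simp add: mult.commute del: of_real_mult)
qed

lemma cmod_weighted_sum:
  fixes p :: "'i \<Rightarrow> complex" and r :: "'i \<Rightarrow> real"
  shows "(cmod (\<Sum>i\<in>I. complex_of_real (r i) * p i))\<^sup>2 =
    (\<Sum>i\<in>I. \<Sum>i'\<in>I. Re (p i * cnj (p i')) * (r i * r i'))"
  unfolding Re_weighted_sum[symmetric] complex_norm_square[symmetric] by simp

text \<open>The weight \<open>Re (p i * cnj (p i'))\<close> is symmetric, so the linear term 2 r(i)
  may be replaced by r(i) + r(i'). For r(i) = m / (a + s m) the bracket becomes
  \<open>rat_kernel\<close>.\<close>

lemma quad_form_rat_kernel:
  fixes p :: "'i \<Rightarrow> complex" and r :: "'i \<Rightarrow> real"
  shows "2 * Re ((\<Sum>i\<in>I. complex_of_real (r i) * p i) * cnj (\<Sum>i\<in>I. p i))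
      - s * (cmod (\<Sum>i\<in>I. complex_of_real (r i) * p i))\<^sup>2 - (cmod (\<Sum>i\<in>I. p i))\<^sup>2 / (1 + s) =
    (\<Sum>i\<in>I. \<Sum>i'\<in>I. Re (p i * cnj (p i')) * (r i + r i' - s * (r i * r i') - 1 / (1 + s)))"
proof -
  let ?S = "\<lambda>f. (\<Sum>i\<in>I. \<Sum>i'\<in>I. Re (p i * cnj (p i')) * f i i')"
  have 1: "Re ((\<Sum>i\<in>I. complex_of_real (r i) * p i) * cnj (\<Sum>i\<in>I. p i)) = ?S (\<lambda>i i'. r i)"
    using Re_weighted_sum[of r p I "\<lambda>_. 1"] by simp
  have "?S (\<lambda>i i'. r i) = (\<Sum>i\<in>I. \<Sum>i'\<in>I. Re (p i' * cnj (p i)) * r i')" by (rule sum.swap)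
  also have "\<dots> = ?S (\<lambda>i i'. r i')" by (intro sum.cong refl) (simp add: algebra_simps)
  finally have 2: "?S (\<lambda>i i'. r i) = ?S (\<lambda>i i'. r i')" .
  have 3: "(cmod (\<Sum>i\<in>I. p i))\<^sup>2 = ?S (\<lambda>i i'. 1)" using cmod_weighted_sum[of "\<lambda>_. 1" p I] by simp
  have "?S (\<lambda>i i'. r i + r i' - s * (r i * r i') - 1 / (1 + s)) =
      ?S (\<lambda>i i'. r i) + ?S (\<lambda>i i'. r i') - s * ?S (\<lambda>i i'. r i * r i') - ?S (\<lambda>i i'. 1) / (1 + s)"
    unfolding sum_distrib_left sum_divide_distrib sum.distrib[symmetric] sum_subtractf[symmetric]
    by (intro sum.cong refl) (simp add: algebra_simps add_divide_distrib diff_divide_distrib)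
  then show ?thesis unfolding 1 3 cmod_weighted_sum using 2 by linarith
qed

text \<open>Completing the square: after multiplication by \<open>D\<close> the gap is the squared
  modulus of \<open>\<mu> * b - D * Y\<close>. It is one coordinate of the tangent bound for the
  quadratic form at m = \<open>\<mu> * b\<close>.\<close>

lemma complex_young:
  assumes "D > 0"
  shows "2 * \<mu> * Re (Y * cnj b) - (cmod Y)\<^sup>2 * D \<le> (cmod b)\<^sup>2 * (\<mu>\<^sup>2 / D)"
proof -
  have "D * (2 * \<mu> * Re (Y * cnj b) - (cmod Y)\<^sup>2 * D) =
      \<mu>\<^sup>2 * (cmod b)\<^sup>2 - (cmod (complex_of_real \<mu> * b - complex_of_real D * Y))\<^sup>2"
    unfolding cmod_power2 by (simp add: power2_eq_square algebra_simps)
  also have "\<dots> \<le> \<mu>\<^sup>2 * (cmod b)\<^sup>2" by simp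
  finally show ?thesis using assms by (simp add: field_simps)
qed

text \<open>With \<open>M\<^sub>0 = exp (H + Q)\<close> and \<open>A\<^sub>0 = exp Q\<close>, the operator with sesquilinear form \<open>Y s\<close> below is
  \<open>y\<^sub>s = (R\<^bsub>A\<^sub>0\<^esub> + s L\<^bsub>M\<^sub>0\<^esub>)\<inverse> M\<^sub>0\<close>, where \<open>L\<close>, \<open>R\<close> are left and right multiplication, and
  \<open>G x s\<close> is the value at \<open>x\<close> of the quadratic form of \<open>y\<^sub>s + y\<^sub>s\<^sup>* - s y\<^sub>s y\<^sub>s\<^sup>* - 1/(1+s)\<close>, which integrates
  to \<open>H + 1\<close>.  The functional is \<open>A \<mapsto> \<integral> tr (y\<^sub>s A y\<^sub>s\<^sup>*) ds = \<Sum> W k l * A k l\<close>.\<close>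
locale lieb =
  fixes d :: nat and H Q :: "nat \<Rightarrow> nat \<Rightarrow> complex" and \<kappa> q :: "nat \<Rightarrow> real" and u v :: "nat \<Rightarrow> nat \<Rightarrow> complex"
  assumes spec_HQ: "spec_decomp d (\<lambda>k l. H k l + Q k l) \<kappa> u" and spec_Q: "spec_decomp d Q q v"
begin

section \<open>The operator y_s in the eigenbases of exp (H + Q) and exp Q\<close>

definition c where "c i j = ip d (u i) (v j)"
text \<open>Left multiplication by exp (H + Q) and right multiplication by exp Q are both diagonal
  on the matrices u_i v_j^H; there y_s has the coefficient \<open>r s i j * c i j\<close>.\<close>

definition r where "r s i j = exp (\<kappa> i) / (exp (q j) + s * exp (\<kappa> i))"

text \<open>\<open>lt\<close> lists the coefficients of the row x^H y_s in the basis
  \<open>v\<close>, and \<open>rt\<close> those of the column y_s z in the basis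
  \<open>u\<close>.\<close>

definition lt where "lt s x j = (\<Sum>i<d. complex_of_real (r s i j) * (c i j * ip d x (u i)))"
definition rt where "rt s i z = (\<Sum>j<d. complex_of_real (r s i j) * (c i j * ip d (v j) z))"
definition Y where "Y s x z = (\<Sum>j<d. lt s x j * ip d (v j) z)"

lemma onb_u: "onb d u" and onb_v: "onb d v"
  using spec_HQ spec_Q by (simp_all add: spec_decomp_def)

lemma Y_left: "Y s x z = ip d (\<lambda>k. \<Sum>j<d. cnj (lt s x j) * v j k) z"
  by (simp add: ip_sum_left Y_def)

lemma Y_right: "Y s x z = ip d x (\<lambda>k. \<Sum>i<d. rt s i z * u i k)"
proof -
  have "Y s x z = (\<Sum>j<d. \<Sum>i<d. complex_of_real (r s i j) * (c i j * ip d x (u i)) * ip d (v j) z)"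
    by (simp add: Y_def lt_def sum_distrib_right)
  also have "\<dots> = (\<Sum>i<d. rt s i z * ip d x (u i))"
    by (subst sum.swap) (unfold rt_def sum_distrib_right, simp add: ac_simps)
  finally show ?thesis by (simp add: ip_sum_right)
qed

text \<open>Both sides are the squared norm of y_s^H x, which every orthonormal basis computes
  alike. Thus \<open>tangent\<close> can start in eigenbases of another point and end with data of
  the base point.\<close>

lemma sum_Y_left:
  assumes "onb d g"
  shows "(\<Sum>j<d. (cmod (Y s x (g j)))\<^sup>2) = (\<Sum>j<d. (cmod (lt s x j))\<^sup>2)"
proof -
  let ?w = "\<lambda>k. \<Sum>j<d. cnj (lt s x j) * v j k"
  have "(\<Sum>j<d. (cmod (Y s x (g j)))\<^sup>2) = (\<Sum>j<d. (cmod (ip d ?w (v j)))\<^sup>2)"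
    unfolding Y_left parseval_norm[OF assms] parseval_norm[OF onb_v] ..
  also have "\<dots> = (\<Sum>j<d. (cmod (lt s x j))\<^sup>2)"
  proof (intro sum.cong refl)
    fix j assume "j \<in> {..<d}"
    then have "ip d (v j) ?w = cnj (lt s x j)" by (simp add: onb_coeff[OF onb_v])
    then have "ip d ?w (v j) = lt s x j" by (metis ip_cnj complex_cnj_cnj)
    then show "(cmod (ip d ?w (v j)))\<^sup>2 = (cmod (lt s x j))\<^sup>2" by simp
  qed
  finally show ?thesis .
qed

lemma sum_Y_right:
  assumes "onb d f"
  shows "(\<Sum>i<d. (cmod (Y s (f i) z))\<^sup>2) = (\<Sum>i<d. (cmod (rt s i z))\<^sup>2)"
proof -
  let ?w = "\<lambda>k. \<Sum>i<d. rt s i z * u i k"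
  have *: "cmod (Y s x z) = cmod (ip d ?w x)" for x
    unfolding Y_right by (subst complex_mod_cnj[symmetric], subst ip_cnj) (rule refl)
  have "(\<Sum>i<d. (cmod (Y s (f i) z))\<^sup>2) = (\<Sum>i<d. (cmod (ip d ?w (u i)))\<^sup>2)"
    unfolding * parseval_norm[OF assms] parseval_norm[OF onb_u] ..
  also have "\<dots> = (\<Sum>i<d. (cmod (rt s i z))\<^sup>2)"
    unfolding *[symmetric] Y_right by (intro sum.cong refl) (simp add: onb_coeff[OF onb_u])
  finally show ?thesis .
qed

lemma sum_Y_ip:
  assumes "onb d g"
  shows "(\<Sum>j<d. Y s x (g j) * ip d (g j) z) = Y s x z"
  unfolding Y_left by (rule parseval[OF assms])

definition G where
  "G x s = 2 * Re (Y s x x) - s * (\<Sum>j<d. (cmod (lt s x j))\<^sup>2) - Re (ip d x x) / (1 + s)"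

lemma expand_v: "ip d x (v j) = (\<Sum>i<d. c i j * ip d x (u i))"
  using parseval[OF onb_u, of x "v j"] by (simp add: c_def mult.commute)

lemma c_orth:
  assumes "i < d" "i' < d"
  shows "(\<Sum>j<d. c i j * cnj (c i' j)) = (if i = i' then 1 else 0)"
  using parseval[OF onb_v, of "u i" "u i'"] onb_u assms by (simp add: c_def ip_cnj onb_def)

text \<open>Expansion in \<open>v\<close> diagonalizes exp Q, so each \<open>j\<close> contributes
  one form as in \<open>quad_form_rat_kernel\<close>, with a = \<open>exp (q j)\<close>.\<close>

lemma G_eq:
  "G x s = (\<Sum>j<d. \<Sum>i<d. \<Sum>i'<d. Re (c i j * ip d x (u i) * cnj (c i' j * ip d x (u i'))) *
     rat_kernel (exp (\<kappa> i)) (exp (\<kappa> i')) (exp (q j)) s)"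
proof -
  have "Re (ip d x x) = (\<Sum>j<d. (cmod (ip d x (v j)))\<^sup>2)" by (simp add: parseval_norm[OF onb_v])
  then have "G x s = (\<Sum>j<d. 2 * Re (lt s x j * cnj (ip d x (v j))) - s * (cmod (lt s x j))\<^sup>2
      - (cmod (ip d x (v j)))\<^sup>2 / (1 + s))"
    by (simp add: G_def Y_def ip_cnj sum_subtractf sum_distrib_left sum_divide_distrib)
  then show ?thesis unfolding lt_def expand_v quad_form_rat_kernel by (simp add: rat_kernel_def r_def)
qed

text \<open>The partial derivative of the relative entropy in its first argument: log exp (H + Q) -
  log exp Q + 1 = H + 1.\<close>

lemma improper_G: "improper (G x) (Re (sesq d H x x) + Re (ip d x x))"
proof -
  let ?p = "\<lambda>i j. c i j * ip d x (u i)"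
  let ?h = "\<lambda>i i'. xlogx_slope (exp (\<kappa> i)) (exp (\<kappa> i'))"
  have "improper (G x) (\<Sum>j<d. \<Sum>i<d. \<Sum>i'<d. Re (?p i j * cnj (?p i' j)) * (?h i i' - ln (exp (q j))))"
    unfolding G_eq[abs_def] by (intro improper_sum improper_cmult improper_kern) auto
  moreover have "(\<Sum>j<d. \<Sum>i<d. \<Sum>i'<d. Re (?p i j * cnj (?p i' j)) * (?h i i' - ln (exp (q j)))) =
      (\<Sum>j<d. \<Sum>i<d. \<Sum>i'<d. Re (?p i j * cnj (?p i' j)) * ?h i i') - (\<Sum>j<d. q j * (cmod (ip d x (v j)))\<^sup>2)"
    (is "_ = ?A - _")
  proof -
    have "(cmod (ip d x (v j)))\<^sup>2 = (\<Sum>i<d. \<Sum>i'<d. Re (?p i j * cnj (?p i' j)))" for j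
      using cmod_weighted_sum[of "\<lambda>_. 1" "\<lambda>i. ?p i j" "{..<d}"] by (simp add: expand_v)
    then have *: "q j * (cmod (ip d x (v j)))\<^sup>2 = (\<Sum>i<d. \<Sum>i'<d. Re (?p i j * cnj (?p i' j)) * q j)" for j
      by (simp only: sum_distrib_left mult.commute)
    show ?thesis unfolding * by (simp add: sum_subtractf right_diff_distrib)
  qed
  moreover have "?A = Re (sesq d (\<lambda>k l. H k l + Q k l) x x) + Re (ip d x x)"
  proof -
    have "?A = (\<Sum>i<d. \<Sum>i'<d. \<Sum>j<d. Re (?p i j * cnj (?p i' j)) * ?h i i')"
      by (subst sum.swap) (rule sum.cong[OF refl], rule sum.swap)
    also have "\<dots> = (\<Sum>i<d. \<Sum>i'<d. Re (ip d x (u i) * cnj (ip d x (u i')) * (\<Sum>j<d. c i j * cnj (c i' j))) * ?h i i')"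
    proof (intro sum.cong refl)
      fix i i'
      have "(\<Sum>j<d. ?p i j * cnj (?p i' j)) = ip d x (u i) * cnj (ip d x (u i')) * (\<Sum>j<d. c i j * cnj (c i' j))"
        by (simp add: sum_distrib_left ac_simps)
      then have "(\<Sum>j<d. Re (?p i j * cnj (?p i' j))) = Re (ip d x (u i) * cnj (ip d x (u i')) * (\<Sum>j<d. c i j * cnj (c i' j)))"
        by (metis Re_sum)
      then show "(\<Sum>j<d. Re (?p i j * cnj (?p i' j)) * ?h i i') =
          Re (ip d x (u i) * cnj (ip d x (u i')) * (\<Sum>j<d. c i j * cnj (c i' j))) * ?h i i'"
        by (simp only: sum_distrib_right[symmetric])
    qed
    \<comment> \<open>Summing over \<open>j\<close> has produced the Kronecker delta of
      \<open>c_orth\<close>. On the diagonal \<open>xlogx_slope\<close> takes the value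
      \<open>\<kappa> i + 1\<close>, the source of both H + Q and the summand 1.\<close>
    also have "\<dots> = (\<Sum>i<d. \<Sum>i'<d. if i = i' then (cmod (ip d x (u i)))\<^sup>2 * ?h i i' else 0)"
      by (intro sum.cong refl) (auto simp: c_orth cmod_power2 simp flip: power2_eq_square)
    also have "\<dots> = (\<Sum>i<d. \<kappa> i * (cmod (ip d x (u i)))\<^sup>2) + (\<Sum>i<d. (cmod (ip d x (u i)))\<^sup>2)"
      by (simp add: xlogx_slope_def sum.distrib algebra_simps)
    finally show ?thesis by (simp add: spec_Re_sesq[OF spec_HQ] parseval_norm[OF onb_u])
  qed
  ultimately show ?thesis by (simp add: sesq_add spec_Re_sesq[OF spec_Q])
qed

text \<open>The functional is A |-> tr (exp (H + Q) Dlog(A)), with Dlog the derivative of the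
  logarithm at exp Q; this is the derivative of A |-> tr exp (H + log A) there.\<close>

definition W where
  "W k l = (\<Sum>i<d. \<Sum>j<d. \<Sum>j'<d. complex_of_real (invlogmean (exp (\<kappa> i)) (exp (q j)) (exp (q j'))) *
     (c i j * cnj (c i j')) * (cnj (v j k) * v j' l))"

definition w where "w z = Re (\<Sum>k<d. \<Sum>l<d. W k l * z k * cnj (z l))"

lemma w_eq: "w z = (\<Sum>i<d. \<Sum>j<d. \<Sum>j'<d. Re (c i j * ip d (v j) z * cnj (c i j' * ip d (v j') z)) *
   invlogmean (exp (\<kappa> i)) (exp (q j)) (exp (q j')))"
proof -
  let ?K = "\<lambda>i j j'. complex_of_real (invlogmean (exp (\<kappa> i)) (exp (q j)) (exp (q j'))) * (c i j * cnj (c i j'))"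
  have "(\<Sum>k<d. \<Sum>l<d. W k l * z k * cnj (z l)) =
     (\<Sum>k<d. \<Sum>l<d. \<Sum>i<d. \<Sum>j<d. \<Sum>j'<d. ?K i j j' * ((cnj (v j k) * z k) * (v j' l * cnj (z l))))"
    unfolding W_def sum_distrib_right by (simp add: ac_simps)
  also have "\<dots> = (\<Sum>i<d. \<Sum>j<d. \<Sum>j'<d. \<Sum>k<d. \<Sum>l<d. ?K i j j' * ((cnj (v j k) * z k) * (v j' l * cnj (z l))))"
  proof -
    have sw: "(\<Sum>k<d. \<Sum>l<d. \<Sum>i<d. f k l i) = (\<Sum>i<d. \<Sum>k<d. \<Sum>l<d. f k l i)" for f :: "nat \<Rightarrow> nat \<Rightarrow> nat \<Rightarrow> complex"
      by (rule trans[OF sum.cong[OF refl sum.swap] sum.swap])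
    show ?thesis
      by (rule trans[OF sw], rule sum.cong[OF refl], rule trans[OF sw], rule sum.cong[OF refl],
          rule trans[OF sw], rule sum.cong[OF refl], rule refl)
  qed
  also have "\<dots> = (\<Sum>i<d. \<Sum>j<d. \<Sum>j'<d. ?K i j j' * (ip d (v j) z * cnj (ip d (v j') z)))"
    by (intro sum.cong refl)
      (simp only: ip_def cnj_sum complex_cnj_mult complex_cnj_cnj, simp only: sum_product, simp only: sum_distrib_left)
  also have "\<dots> = (\<Sum>i<d. \<Sum>j<d. \<Sum>j'<d. (c i j * ip d (v j) z * cnj (c i j' * ip d (v j') z)) *
     complex_of_real (invlogmean (exp (\<kappa> i)) (exp (q j)) (exp (q j'))))"
    by (intro sum.cong refl) (simp add: ac_simps)
  finally show ?thesis by (simp add: w_def)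
qed

text \<open>\<open>w z\<close> is the functional at the rank-one matrix z z^H, and the integrand is
  the squared norm of y_s z. Positivity of the functional follows.\<close>

lemma improper_w: "improper (\<lambda>s. \<Sum>i<d. (cmod (rt s i z))\<^sup>2) (w z)"
  unfolding rt_def cmod_weighted_sum w_eq r_def
  by (intro improper_sum improper_cmult improper_invlogmean) auto

lemma w_nonneg: "0 \<le> w z"
  by (rule improper_nonneg[OF improper_w]) (simp add: sum_nonneg)

text \<open>Contact at the base point: the derivative of log at exp Q sends exp Q to the identity,
  so the functional returns tr exp (H + Q).\<close>

lemma w_base: "(\<Sum>j<d. exp (q j) * w (v j)) = (\<Sum>i<d. exp (\<kappa> i))"
proof -
  have "exp (q l) * w (v l) = (\<Sum>i<d. (cmod (ip d (u i) (v l)))\<^sup>2 * exp (\<kappa> i))" if l: "l < d" for l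
  proof -
    have *: "ip d (v j) (v l) = (if j = l then 1 else 0)" if "j < d" for j
      using onb_v that l by (simp add: onb_def)
    \<comment> \<open>For z = \<open>v l\<close> only j = j' = l survives, where
      \<open>invlogmean\<close> takes its diagonal value and cancels the factor
      \<open>exp (q l)\<close>.\<close>
    have "w (v l) = (\<Sum>i<d. \<Sum>j<d. \<Sum>j'<d. if j' = l then (if j = l then (cmod (c i l))\<^sup>2 * (exp (\<kappa> i) / exp (q l)) else 0) else 0)"
      unfolding w_eq by (intro sum.cong refl) (auto simp: * cmod_power2 invlogmean_def simp flip: power2_eq_square)
    then have "w (v l) = (\<Sum>i<d. (cmod (c i l))\<^sup>2 * (exp (\<kappa> i) / exp (q l)))"
      using l by simp
    then show ?thesis by (simp add: sum_distrib_left c_def)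
  qed
  then have "(\<Sum>j<d. exp (q j) * w (v j)) = (\<Sum>j<d. \<Sum>i<d. (cmod (ip d (u i) (v j)))\<^sup>2 * exp (\<kappa> i))" by simp
  also have "\<dots> = (\<Sum>i<d. (\<Sum>j<d. (cmod (ip d (u i) (v j)))\<^sup>2) * exp (\<kappa> i))"
    by (subst sum.swap) (simp add: sum_distrib_right)
  also have "\<dots> = (\<Sum>i<d. exp (\<kappa> i))"
    using onb_u by (simp add: parseval_norm[OF onb_v] onb_def)
  finally show ?thesis .
qed

text \<open>Connects two views of the functional: weights \<open>w\<close> in an eigenbasis, suited
  to comparing eigenvalues, and a linear form in the entries, suited to taking expectations.\<close>

lemma w_spec:
  assumes "spec_decomp d A a g"
  shows "(\<Sum>j<d. a j * w (g j)) = Re (\<Sum>k<d. \<Sum>l<d. W k l * A k l)"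
proof -
  have eq: "a j * w (g j) = Re (\<Sum>k<d. \<Sum>l<d. W k l * (complex_of_real (a j) * g j k * cnj (g j l)))" for j
  proof -
    have "(\<Sum>k<d. \<Sum>l<d. W k l * (complex_of_real (a j) * g j k * cnj (g j l))) =
        complex_of_real (a j) * (\<Sum>k<d. \<Sum>l<d. W k l * g j k * cnj (g j l))"
      unfolding sum_distrib_left by (simp add: ac_simps)
    then show ?thesis by (simp add: w_def del: Re_sum)
  qed
  have "(\<Sum>j<d. a j * w (g j)) = Re (\<Sum>j<d. \<Sum>k<d. \<Sum>l<d. W k l * (complex_of_real (a j) * g j k * cnj (g j l)))"
    by (simp only: eq Re_sum)
  also have "(\<Sum>j<d. \<Sum>k<d. \<Sum>l<d. W k l * (complex_of_real (a j) * g j k * cnj (g j l))) =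
      (\<Sum>k<d. \<Sum>l<d. W k l * (\<Sum>j<d. complex_of_real (a j) * g j k * cnj (g j l)))"
    unfolding sum_distrib_left by (subst sum.swap) (rule sum.cong[OF refl], rule sum.swap)
  also have "\<dots> = (\<Sum>k<d. \<Sum>l<d. W k l * A k l)"
    using assms by (intro sum.cong refl) (simp add: spec_decomp_def)
  finally show ?thesis .
qed

lemma tangent:
  assumes P: "spec_decomp d P \<pi> g" and HP: "spec_decomp d (\<lambda>k l. H k l + P k l) \<eta> f"
  shows "(\<Sum>i<d. exp (\<eta> i)) \<le> (\<Sum>j<d. exp (\<pi> j) * w (g j))"
proof -
  let ?b = "\<lambda>i j. ip d (f i) (g j)"
  have onb: "onb d f" "onb d g" using P HP by (simp_all add: spec_decomp_def)
  have b1: "(\<Sum>j<d. (cmod (?b i j))\<^sup>2) = 1" if "i < d" for i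
    using onb that by (simp add: parseval_norm[OF onb(2)] onb_def)
  \<comment> \<open>\<open>complex_young\<close> is summed over pairs of eigenvectors
    \<open>f i\<close> of exp (H + P) and \<open>g j\<close> of exp P, with b the overlap of the
    two, Y the matrix element of y_s, and D the eigenvalue of R_A + s L_M.\<close>
  have point: "(\<Sum>i<d. exp (\<eta> i) * G (f i) s) - (\<Sum>j<d. exp (\<pi> j) * (\<Sum>i<d. (cmod (rt s i (g j)))\<^sup>2)) \<le>
      (\<Sum>i<d. \<Sum>j<d. (cmod (?b i j))\<^sup>2 * ((exp (\<eta> i))\<^sup>2 / (exp (\<pi> j) + s * exp (\<eta> i)) - exp (\<eta> i) / (1 + s)))"
    if s: "s \<ge> 0" for s
  proof -
    let ?y = "\<lambda>i j. Y s (f i) (g j)"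
    have "(\<Sum>i<d. \<Sum>j<d. 2 * exp (\<eta> i) * Re (?y i j * cnj (?b i j)) - (cmod (?y i j))\<^sup>2 * (exp (\<pi> j) + s * exp (\<eta> i)))
        \<le> (\<Sum>i<d. \<Sum>j<d. (cmod (?b i j))\<^sup>2 * ((exp (\<eta> i))\<^sup>2 / (exp (\<pi> j) + s * exp (\<eta> i))))"
      using s by (intro sum_mono complex_young) (simp add: add_pos_nonneg)
    moreover have "(\<Sum>i<d. \<Sum>j<d. 2 * exp (\<eta> i) * Re (?y i j * cnj (?b i j)) - (cmod (?y i j))\<^sup>2 * (exp (\<pi> j) + s * exp (\<eta> i)))
       = (\<Sum>i<d. exp (\<eta> i) * (2 * Re (Y s (f i) (f i)) - s * (\<Sum>j<d. (cmod (lt s (f i) j))\<^sup>2)))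
        - (\<Sum>j<d. exp (\<pi> j) * (\<Sum>i<d. (cmod (rt s i (g j)))\<^sup>2))"
    proof -
      have "(\<Sum>i<d. \<Sum>j<d. 2 * exp (\<eta> i) * Re (?y i j * cnj (?b i j)) - (cmod (?y i j))\<^sup>2 * (exp (\<pi> j) + s * exp (\<eta> i)))
        = (\<Sum>i<d. exp (\<eta> i) * (2 * Re (\<Sum>j<d. ?y i j * ip d (g j) (f i)) - s * (\<Sum>j<d. (cmod (?y i j))\<^sup>2)))
         - (\<Sum>i<d. \<Sum>j<d. exp (\<pi> j) * (cmod (?y i j))\<^sup>2)"
        unfolding ip_cnj Re_sum sum_distrib_left sum_subtractf[symmetric]
        by (intro sum.cong refl) (simp add: algebra_simps)
      also have "(\<Sum>i<d. \<Sum>j<d. exp (\<pi> j) * (cmod (?y i j))\<^sup>2) = (\<Sum>j<d. exp (\<pi> j) * (\<Sum>i<d. (cmod (?y i j))\<^sup>2))"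
        by (subst sum.swap) (simp add: sum_distrib_left)
      finally show ?thesis unfolding sum_Y_ip[OF onb(2)] sum_Y_left[OF onb(2)] sum_Y_right[OF onb(1)] .
    qed
    moreover have "(\<Sum>i<d. \<Sum>j<d. (cmod (?b i j))\<^sup>2 * (exp (\<eta> i) / (1 + s))) = (\<Sum>i<d. exp (\<eta> i) * (Re (ip d (f i) (f i)) / (1 + s)))"
      unfolding sum_distrib_right[symmetric] using onb(1) by (simp add: b1 onb_def)
    ultimately show ?thesis
      by (simp add: G_def right_diff_distrib sum_subtractf)
  qed
  have lhs: "improper (\<lambda>s. (\<Sum>i<d. exp (\<eta> i) * G (f i) s) - (\<Sum>j<d. exp (\<pi> j) * (\<Sum>i<d. (cmod (rt s i (g j)))\<^sup>2)))
     ((\<Sum>i<d. exp (\<eta> i) * (Re (sesq d H (f i) (f i)) + Re (ip d (f i) (f i)))) - (\<Sum>j<d. exp (\<pi> j) * w (g j)))"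
    by (intro improper_diff improper_sum improper_cmult improper_G improper_w) auto
  have rhs: "improper (\<lambda>s. \<Sum>i<d. \<Sum>j<d. (cmod (?b i j))\<^sup>2 * ((exp (\<eta> i))\<^sup>2 / (exp (\<pi> j) + s * exp (\<eta> i)) - exp (\<eta> i) / (1 + s)))
     (\<Sum>i<d. \<Sum>j<d. (cmod (?b i j))\<^sup>2 * (exp (\<eta> i) * (ln (exp (\<eta> i)) - ln (exp (\<pi> j)))))"
    by (intro improper_sum improper_cmult improper_log) auto
  \<comment> \<open>The \<open>i\<close>-th term of tr M (log M - log A) for M = exp (H + P) and A =
    exp P, where the difference of the logarithms is H. It later cancels against the H in H +
    1.\<close>
  have "(\<Sum>j<d. (cmod (?b i j))\<^sup>2 * (exp (\<eta> i) * (ln (exp (\<eta> i)) - ln (exp (\<pi> j))))) = exp (\<eta> i) * Re (sesq d H (f i) (f i))"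
    if i: "i < d" for i
  proof -
    have "Re (sesq d (\<lambda>k l. H k l + P k l) (f i) (f i)) = (\<Sum>j<d. if i = j then \<eta> j else 0)"
      unfolding spec_Re_sesq[OF HP] using onb(1) i by (intro sum.cong refl) (auto simp: onb_def)
    then have "Re (sesq d H (f i) (f i)) = \<eta> i * (\<Sum>j<d. (cmod (?b i j))\<^sup>2) - (\<Sum>j<d. \<pi> j * (cmod (?b i j))\<^sup>2)"
      using i b1[OF i] by (simp add: sesq_add spec_Re_sesq[OF P])
    also have "\<dots> = (\<Sum>j<d. (cmod (?b i j))\<^sup>2 * (\<eta> i - \<pi> j))"
      by (simp add: sum_distrib_left sum_subtractf algebra_simps)
    finally show ?thesis by (simp add: sum_distrib_left ac_simps)
  qed
  with improper_le[OF lhs rhs point] have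
    "(\<Sum>i<d. exp (\<eta> i) * (Re (sesq d H (f i) (f i)) + Re (ip d (f i) (f i)))) - (\<Sum>j<d. exp (\<pi> j) * w (g j))
      \<le> (\<Sum>i<d. exp (\<eta> i) * Re (sesq d H (f i) (f i)))" by simp
  moreover have "(\<Sum>i<d. exp (\<eta> i) * (Re (sesq d H (f i) (f i)) + Re (ip d (f i) (f i)))) =
      (\<Sum>i<d. exp (\<eta> i) * Re (sesq d H (f i) (f i)) + exp (\<eta> i))"
    using onb(1) by (intro sum.cong refl) (simp add: onb_def distrib_left)
  ultimately show ?thesis unfolding sum.distrib by linarith
qed

end

section \<open>One random matrix\<close>

lemma spec_affine:
  assumes "spec_decomp d A a u"
  shows "spec_decomp d (\<lambda>k l. complex_of_real x * (if k = l then 1 else 0) + complex_of_real y * A k l) (\<lambda>i. x + y * a i) u"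
  unfolding spec_decomp_def
proof (intro conjI allI impI)
  show "onb d u" using assms by (simp add: spec_decomp_def)
  fix k l assume kl: "k < d" "l < d"
  have A: "A k l = (\<Sum>i<d. complex_of_real (a i) * u i k * cnj (u i l))"
    using assms kl by (simp add: spec_decomp_def)
  show "complex_of_real x * (if k = l then 1 else 0) + complex_of_real y * A k l =
      (\<Sum>i<d. complex_of_real (x + y * a i) * u i k * cnj (u i l))"
    unfolding A onb_complete[OF \<open>onb d u\<close> kl, symmetric] sum_distrib_left sum.distrib[symmetric]
    by (intro sum.cong refl) (simp add: algebra_simps)
qed

lemma spec_scale:
  assumes "spec_decomp d A a u"
  shows "spec_decomp d (\<lambda>k l. complex_of_real y * A k l) (\<lambda>i. y * a i) u"
  using spec_affine[OF assms, of 0 y] by simp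

lemma hermitian_on_add: "hermitian_on d A \<Longrightarrow> hermitian_on d B \<Longrightarrow> hermitian_on d (\<lambda>k l. A k l + B k l)"
  unfolding hermitian_on_def by (metis complex_cnj_add)

lemma hermitian_on_scale: "hermitian_on d A \<Longrightarrow> hermitian_on d (\<lambda>k l. complex_of_real c * A k l)"
  unfolding hermitian_on_def by (metis complex_cnj_mult complex_cnj_complex_of_real)

lemma hermitian_on_zero: "hermitian_on d (\<lambda>k l. 0)"
  by (simp add: hermitian_on_def)

lemma hermitian_on_sum:
  assumes "\<And>i. i \<in> I \<Longrightarrow> hermitian_on d (A i)"
  shows "hermitian_on d (\<lambda>k l. \<Sum>i\<in>I. A i k l)"
  using assms by (induction I rule: infinite_finite_induct) (auto simp: hermitian_on_zero intro: hermitian_on_add)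

lemma exp_chord:
  fixes s x :: real
  assumes "0 \<le> x" "x \<le> 1"
  shows "exp (s * x) \<le> 1 + (exp s - 1) * x"
proof -
  have "exp ((1 - x) *\<^sub>R 0 + x *\<^sub>R s) \<le> (1 - x) * exp 0 + x * exp s"
    using assms by (intro convex_onD[OF exp_convex]) auto
  then show ?thesis by (simp add: algebra_simps)
qed

lemma (in prob_space) trexp_one_step:
  fixes Y :: "'a \<Rightarrow> nat \<Rightarrow> nat \<Rightarrow> complex" and s :: real
  assumes H: "hermitian_on d H"
    and Y: "\<And>\<omega>. \<omega> \<in> space M \<Longrightarrow> hermitian_on d (Y \<omega>)"
    and bnd: "AE \<omega> in M. \<exists>a u. spec_decomp d (Y \<omega>) a u \<and> (\<forall>i<d. 0 \<le> a i \<and> a i \<le> 1)"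
    and int: "\<And>k l. k < d \<Longrightarrow> l < d \<Longrightarrow> integrable M (\<lambda>\<omega>. Y \<omega> k l)"
    and Z: "\<And>k l. k < d \<Longrightarrow> l < d \<Longrightarrow> Z k l = expectation (\<lambda>\<omega>. Y \<omega> k l)" "hermitian_on d Z"
  shows "(\<integral>\<^sup>+\<omega>. ennreal (trexp d (\<lambda>k l. H k l + complex_of_real s * Y \<omega> k l)) \<partial>M)
     \<le> ennreal (trexp d (\<lambda>k l. H k l + complex_of_real (exp s - 1) * Z k l))"
proof -
  define g where "g = exp s - 1"
  let ?Q = "\<lambda>k l. complex_of_real g * Z k l"
  obtain q v where q: "spec_decomp d ?Q q v" using spectral[OF hermitian_on_scale[OF Z(2)]] by blast
  obtain \<kappa> u where \<kappa>: "spec_decomp d (\<lambda>k l. H k l + ?Q k l) \<kappa> u"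
    using spectral[OF hermitian_on_add[OF H hermitian_on_scale[OF Z(2)]]] by blast
  interpret lieb d H ?Q \<kappa> q u v by standard (fact \<kappa> q)+
  \<comment> \<open>The value L(1 + (e^s - 1) Y) in entry form; the factor
    \<open>complex_of_real 1\<close> gives it the shape of \<open>spec_affine\<close>.\<close>
  define f where "f \<omega> = Re (\<Sum>k<d. \<Sum>l<d. W k l * (complex_of_real 1 * (if k = l then 1 else 0) + complex_of_real g * Y \<omega> k l))" for \<omega>
  have le: "AE \<omega> in M. trexp d (\<lambda>k l. H k l + complex_of_real s * Y \<omega> k l) \<le> f \<omega>"
    using bnd AE_space
  proof eventually_elim
    fix \<omega> assume "\<exists>a u. spec_decomp d (Y \<omega>) a u \<and> (\<forall>i<d. 0 \<le> a i \<and> a i \<le> 1)" and \<omega>: "\<omega> \<in> space M"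
    then obtain a z where a: "spec_decomp d (Y \<omega>) a z" "\<And>i. i < d \<Longrightarrow> 0 \<le> a i \<and> a i \<le> 1" by blast
    obtain \<eta> e where \<eta>: "spec_decomp d (\<lambda>k l. H k l + complex_of_real s * Y \<omega> k l) \<eta> e"
      using spectral[OF hermitian_on_add[OF H hermitian_on_scale[OF Y[OF \<omega>]]]] by blast
    have "trexp d (\<lambda>k l. H k l + complex_of_real s * Y \<omega> k l) = (\<Sum>i<d. exp (\<eta> i))"
      by (rule trexp_eq[OF \<eta>])
    also have "\<dots> \<le> (\<Sum>j<d. exp (s * a j) * w (z j))"
      by (rule tangent[OF spec_scale[OF a(1)] \<eta>])
    also have "\<dots> \<le> (\<Sum>j<d. (1 + g * a j) * w (z j))"
      using a(2) unfolding g_def by (intro sum_mono mult_right_mono exp_chord w_nonneg) auto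
    also have "\<dots> = f \<omega>"
      unfolding f_def by (rule w_spec[OF spec_affine[OF a(1)]])
    finally show "trexp d (\<lambda>k l. H k l + complex_of_real s * Y \<omega> k l) \<le> f \<omega>" .
  qed
  have int_e: "integrable M (\<lambda>\<omega>. W k l * (complex_of_real 1 * (if k = l then 1 else 0) + complex_of_real g * Y \<omega> k l))"
    if "k < d" "l < d" for k l
    using int[OF that] by (intro integrable_mult_right Bochner_Integration.integrable_add) auto
  have f_int: "integrable M f"
    unfolding f_def by (intro integrable_Re Bochner_Integration.integrable_sum int_e) auto
  have "(\<integral>\<omega>. f \<omega> \<partial>M) = Re (\<Sum>k<d. \<Sum>l<d. W k l * (complex_of_real 1 * (if k = l then 1 else 0) + complex_of_real 1 * ?Q k l))"
  proof -
    have "(\<integral>\<omega>. f \<omega> \<partial>M) = Re (\<integral>\<omega>. (\<Sum>k<d. \<Sum>l<d. W k l * (complex_of_real 1 * (if k = l then 1 else 0) + complex_of_real g * Y \<omega> k l)) \<partial>M)"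
      unfolding f_def by (intro integral_Re Bochner_Integration.integrable_sum int_e) auto
    also have "(\<integral>\<omega>. (\<Sum>k<d. \<Sum>l<d. W k l * (complex_of_real 1 * (if k = l then 1 else 0) + complex_of_real g * Y \<omega> k l)) \<partial>M)
      = (\<Sum>k<d. \<Sum>l<d. (\<integral>\<omega>. W k l * (complex_of_real 1 * (if k = l then 1 else 0) + complex_of_real g * Y \<omega> k l) \<partial>M))"
      by (rule trans[OF Bochner_Integration.integral_sum sum.cong[OF refl Bochner_Integration.integral_sum]])
         (intro Bochner_Integration.integrable_sum int_e; simp)+
    also have "\<dots> = (\<Sum>k<d. \<Sum>l<d. W k l * (complex_of_real 1 * (if k = l then 1 else 0) + complex_of_real 1 * ?Q k l))"
    proof (intro sum.cong refl)
      fix k l assume kl: "k \<in> {..<d}" "l \<in> {..<d}"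
      then have i: "integrable M (\<lambda>\<omega>. Y \<omega> k l)" by (simp add: int)
      show "(\<integral>\<omega>. W k l * (complex_of_real 1 * (if k = l then 1 else 0) + complex_of_real g * Y \<omega> k l) \<partial>M) =
        W k l * (complex_of_real 1 * (if k = l then 1 else 0) + complex_of_real 1 * ?Q k l)"
        using i kl by (simp add: Z(1) Bochner_Integration.integral_add prob_space)
    qed
    finally show ?thesis .
  qed
  also have "\<dots> = (\<Sum>j<d. (1 + 1 * q j) * w (v j))"
    by (rule w_spec[OF spec_affine[OF q], symmetric])
  also have "\<dots> \<le> (\<Sum>j<d. exp (q j) * w (v j))"
    using exp_ge_add_one_self by (intro sum_mono mult_right_mono w_nonneg) auto
  also have "\<dots> = trexp d (\<lambda>k l. H k l + ?Q k l)"
    unfolding w_base trexp_eq[OF \<kappa>] ..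
  finally have E: "(\<integral>\<omega>. f \<omega> \<partial>M) \<le> trexp d (\<lambda>k l. H k l + ?Q k l)" .
  have pos: "AE \<omega> in M. 0 \<le> f \<omega>"
    using le AE_space
  proof eventually_elim
    fix \<omega> assume 1: "trexp d (\<lambda>k l. H k l + complex_of_real s * Y \<omega> k l) \<le> f \<omega>" and \<omega>: "\<omega> \<in> space M"
    have "0 \<le> trexp d (\<lambda>k l. H k l + complex_of_real s * Y \<omega> k l)"
      by (intro trexp_nonneg hermitian_on_add H hermitian_on_scale Y \<omega>)
    with 1 show "0 \<le> f \<omega>" by simp
  qed
  have "(\<integral>\<^sup>+\<omega>. ennreal (trexp d (\<lambda>k l. H k l + complex_of_real s * Y \<omega> k l)) \<partial>M) \<le> (\<integral>\<^sup>+\<omega>. ennreal (f \<omega>) \<partial>M)"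
    using le by (intro nn_integral_mono_AE) (auto elim!: eventually_mono intro: ennreal_leI)
  also have "\<dots> = ennreal (\<integral>\<omega>. f \<omega> \<partial>M)" by (rule nn_integral_eq_integral[OF f_int pos])
  also have "\<dots> \<le> ennreal (trexp d (\<lambda>k l. H k l + ?Q k l))" by (rule ennreal_leI[OF E])
  finally show ?thesis by (simp add: g_def)
qed

section \<open>Sums of independent random matrices\<close>

lemma (in product_sigma_finite) trexp_product:
  assumes "finite J"
    and meas: "\<And>i k l. i \<in> J \<Longrightarrow> k < d \<Longrightarrow> l < d \<Longrightarrow> (\<lambda>y. B y k l) \<in> borel_measurable (M i)"
    and B: "\<And>y. hermitian_on d (B y)"
    and Z: "\<And>i. i \<in> J \<Longrightarrow> hermitian_on d (Z i)"
    and step: "\<And>i H. i \<in> J \<Longrightarrow> hermitian_on d H \<Longrightarrow>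
      (\<integral>\<^sup>+y. ennreal (trexp d (\<lambda>k l. H k l + complex_of_real s * B y k l)) \<partial>M i)
        \<le> ennreal (trexp d (\<lambda>k l. H k l + complex_of_real g * Z i k l))"
    and "hermitian_on d C"
  shows "(\<integral>\<^sup>+x. ennreal (trexp d (\<lambda>k l. C k l + complex_of_real s * (\<Sum>i\<in>J. B (x i) k l))) \<partial>Pi\<^sub>M J M)
    \<le> ennreal (trexp d (\<lambda>k l. C k l + complex_of_real g * (\<Sum>i\<in>J. Z i k l)))"
  using assms
proof (induction J arbitrary: C rule: finite_induct)
  case empty
  then show ?case by (simp add: PiM_empty nn_integral_count_space_finite)
next
  case (insert i J)
  let ?f = "\<lambda>x. ennreal (trexp d (\<lambda>k l. C k l + complex_of_real s * (\<Sum>i\<in>insert i J. B (x i) k l)))"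
  have comp: "(\<lambda>x. B (x j) k l) \<in> borel_measurable (Pi\<^sub>M (insert i J) M)" if "j \<in> insert i J" "k < d" "l < d" for j k l
    using measurable_component_singleton[OF that(1)] insert.prems(1)[OF that]
    by (rule measurable_compose[where f = "\<lambda>x. x j" and g = "\<lambda>y. B y k l" and N = "M j"])
  have f: "?f \<in> borel_measurable (Pi\<^sub>M (insert i J) M)"
    by (intro measurable_compose[OF _ measurable_ennreal] trexp_measurable borel_measurable_add borel_measurable_times
        borel_measurable_const borel_measurable_sum comp) auto
  have "integral\<^sup>N (Pi\<^sub>M (insert i J) M) ?f = (\<integral>\<^sup>+x. (\<integral>\<^sup>+y. ?f (x(i := y)) \<partial>M i) \<partial>Pi\<^sub>M J M)"
    by (rule product_nn_integral_insert[OF insert.hyps f])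
  also have "\<dots> \<le> (\<integral>\<^sup>+x. ennreal (trexp d (\<lambda>k l. (C k l + complex_of_real g * Z i k l) + complex_of_real s * (\<Sum>i\<in>J. B (x i) k l))) \<partial>Pi\<^sub>M J M)"
  proof (intro nn_integral_mono)
    fix x
    let ?H = "\<lambda>k l. C k l + complex_of_real s * (\<Sum>i\<in>J. B (x i) k l)"
    have H: "hermitian_on d ?H"
      by (intro hermitian_on_add hermitian_on_scale hermitian_on_sum insert.prems)
    have eq: "(\<lambda>k l. C k l + complex_of_real s * (\<Sum>j\<in>insert i J. B ((x(i := y)) j) k l)) =
       (\<lambda>k l. ?H k l + complex_of_real s * B y k l)" for y
    proof (intro ext)
      fix k l
      have "(\<Sum>j\<in>J. B ((x(i := y)) j) k l) = (\<Sum>j\<in>J. B (x j) k l)"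
        using insert.hyps by (intro sum.cong refl) auto
      then show "C k l + complex_of_real s * (\<Sum>j\<in>insert i J. B ((x(i := y)) j) k l) = ?H k l + complex_of_real s * B y k l"
        using insert.hyps by (simp add: algebra_simps)
    qed
    have "(\<integral>\<^sup>+y. ?f (x(i := y)) \<partial>M i) = (\<integral>\<^sup>+y. ennreal (trexp d (\<lambda>k l. ?H k l + complex_of_real s * B y k l)) \<partial>M i)"
      unfolding eq ..
    also have "\<dots> \<le> ennreal (trexp d (\<lambda>k l. ?H k l + complex_of_real g * Z i k l))"
      by (rule insert.prems(4)[OF _ H]) simp
    also have "(\<lambda>k l. ?H k l + complex_of_real g * Z i k l) =
       (\<lambda>k l. (C k l + complex_of_real g * Z i k l) + complex_of_real s * (\<Sum>i\<in>J. B (x i) k l))"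
      by (simp add: algebra_simps)
    finally show "(\<integral>\<^sup>+y. ?f (x(i := y)) \<partial>M i) \<le> ennreal (trexp d (\<lambda>k l. (C k l + complex_of_real g * Z i k l) + complex_of_real s * (\<Sum>i\<in>J. B (x i) k l)))" .
  qed
  also have "\<dots> \<le> ennreal (trexp d (\<lambda>k l. (C k l + complex_of_real g * Z i k l) + complex_of_real g * (\<Sum>i\<in>J. Z i k l)))"
    using insert.prems by (intro insert.IH hermitian_on_add hermitian_on_scale) auto
  also have "(\<lambda>k l. (C k l + complex_of_real g * Z i k l) + complex_of_real g * (\<Sum>i\<in>J. Z i k l)) =
     (\<lambda>k l. C k l + complex_of_real g * (\<Sum>i\<in>insert i J. Z i k l))"
    using insert.hyps by (simp add: algebra_simps)
  finally show ?case .
qed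

section \<open>Block circulant matrices\<close>

definition bcirc_entry :: "nat \<Rightarrow> nat \<Rightarrow> tensor \<Rightarrow> nat \<Rightarrow> nat \<Rightarrow> complex" where
  "bcirc_entry m p A k l = A (k mod m, l mod m, nat ((int (k div m) - int (l div m)) mod int p))"

lemma bcirc_eq_entries: "bcirc m m p A = mat (m * p) (m * p) (\<lambda>(k, l). bcirc_entry m p A k l)"
  by (simp add: bcirc_def bcirc_entry_def)

lemma bcirc_entry_idx:
  assumes "m \<ge> 1" "p \<ge> 1"
  shows "(k mod m, l mod m, nat ((int (k div m) - int (l div m)) mod int p)) \<in> tensor_idx m m p"
  using assms by (auto simp: tensor_idx_def nat_less_iff)

text \<open>Transposition of a block circulant matrix exchanges block row and block column and so
  negates their difference \<open>z\<close>; modulo \<open>p\<close> this is the slice reversal of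
  \<open>tconjT\<close>.\<close>

lemma mod_neg_nat:
  assumes "p \<ge> 1"
  shows "(p - nat (z mod int p)) mod p = nat ((- z) mod int p)"
proof -
  have "nat (z mod int p) \<le> p" using assms by (simp add: nat_le_iff order_less_imp_le)
  then have "int ((p - nat (z mod int p)) mod p) = (int p - z mod int p) mod int p"
    using assms by (simp add: zmod_int of_nat_diff)
  also have "\<dots> = (- z) mod int p" by (simp add: mod_diff_right_eq mod_diff_left_eq) (metis diff_0 minus_mod_self1 mod_diff_cong mod_minus_eq mod_mod_trivial)
  finally show ?thesis by (metis nat_int)
qed

lemma bcirc_entry_hermitian:
  assumes "m \<ge> 1" "p \<ge> 1" "t_hermitian m p A"
  shows "bcirc_entry m p A k l = cnj (bcirc_entry m p A l k)"
proof -
  let ?z = "int (k div m) - int (l div m)"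
  have "tconjT p A (k mod m, l mod m, nat (?z mod int p)) = A (k mod m, l mod m, nat (?z mod int p))"
    using assms(3) bcirc_entry_idx[OF assms(1,2)] by (auto simp: t_hermitian_def)
  then show ?thesis
    using mod_neg_nat[OF assms(2), of ?z] by (simp add: tconjT_def bcirc_entry_def)
qed

lemma bcirc_entry_hermitian_on: "m \<ge> 1 \<Longrightarrow> p \<ge> 1 \<Longrightarrow> t_hermitian m p A \<Longrightarrow> hermitian_on d (bcirc_entry m p A)"
  unfolding hermitian_on_def using bcirc_entry_hermitian by blast

text \<open>Symmetrized so that it is Hermitian for every tensor, including the null set of the product
  space where the samples need not be.\<close>
definition bcirc_herm :: "nat \<Rightarrow> nat \<Rightarrow> tensor \<Rightarrow> nat \<Rightarrow> nat \<Rightarrow> complex" where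
  "bcirc_herm m p A k l = (bcirc_entry m p A k l + cnj (bcirc_entry m p A l k)) / 2"

lemma bcirc_herm_hermitian: "hermitian_on d (bcirc_herm m p A)"
  by (auto simp: hermitian_on_def bcirc_herm_def add.commute)

lemma bcirc_herm_eq: "m \<ge> 1 \<Longrightarrow> p \<ge> 1 \<Longrightarrow> t_hermitian m p A \<Longrightarrow> bcirc_herm m p A = bcirc_entry m p A"
  using bcirc_entry_hermitian[of m p A] by (auto simp: bcirc_herm_def fun_eq_iff simp flip: bcirc_entry_hermitian)

lemma bcirc_entry_restrict:
  assumes "m \<ge> 1" "p \<ge> 1"
  shows "bcirc_entry m p (restrict A (tensor_idx m m p)) = bcirc_entry m p A"
  using bcirc_entry_idx[OF assms] by (simp add: bcirc_entry_def fun_eq_iff)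

lemma bcirc_entry_measurable:
  assumes "m \<ge> 1" "p \<ge> 1"
  shows "(\<lambda>A. bcirc_entry m p A k l) \<in> borel_measurable (Pi\<^sub>M (tensor_idx m m p) (\<lambda>_. borel))"
  unfolding bcirc_entry_def by (rule measurable_component_singleton[OF bcirc_entry_idx[OF assms]])

lemma bcirc_herm_measurable:
  assumes "m \<ge> 1" "p \<ge> 1"
  shows "(\<lambda>A. bcirc_herm m p A k l) \<in> borel_measurable (Pi\<^sub>M (tensor_idx m m p) (\<lambda>_. borel))"
proof -
  note [measurable] = bcirc_entry_measurable[OF assms]
  have [measurable]: "cnj \<in> borel_measurable borel"
    by (intro borel_measurable_continuous_onI continuous_intros)
  show ?thesis unfolding bcirc_herm_def by measurable
qed

section \<open>Entry bounds, extreme eigenvalues and positivity from spectral decompositions\<close>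

lemma onb_entry_le:
  assumes "onb d u" "i < d" "k < d"
  shows "cmod (u i k) \<le> 1"
proof -
  have "complex_of_real (\<Sum>i<d. (cmod (u i k))\<^sup>2) = (\<Sum>i<d. u i k * cnj (u i k))"
    by (simp add: complex_norm_square del: of_real_power)
  then have "(\<Sum>i<d. (cmod (u i k))\<^sup>2) = 1"
    unfolding onb_complete[OF assms(1,3,3)] by (metis of_real_eq_1_iff)
  moreover have "(cmod (u i k))\<^sup>2 \<le> (\<Sum>i<d. (cmod (u i k))\<^sup>2)"
    using assms(2) by (intro member_le_sum) auto
  ultimately have "(cmod (u i k))\<^sup>2 \<le> 1\<^sup>2" by simp
  then show ?thesis by (rule power2_le_imp_le) simp
qed

text \<open>A crude bound that makes the entries of the random matrices integrable.\<close>

lemma spec_entry_le: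
  assumes "spec_decomp d A a u" "\<And>i. i < d \<Longrightarrow> \<bar>a i\<bar> \<le> T" "k < d" "l < d"
  shows "cmod (A k l) \<le> real d * T"
proof -
  have onb: "onb d u" using assms(1) by (simp add: spec_decomp_def)
  have "cmod (A k l) \<le> (\<Sum>i<d. cmod (complex_of_real (a i) * u i k * cnj (u i l)))"
    using assms by (simp add: spec_decomp_def norm_sum)
  also have "\<dots> \<le> (\<Sum>i<d. T)"
  proof (intro sum_mono)
    fix i assume i: "i \<in> {..<d}"
    have "\<bar>a i\<bar> * (cmod (u i k) * cmod (u i l)) \<le> T * (1 * 1)"
      using i assms onb_entry_le[OF onb] by (intro mult_mono) (auto intro: order_trans[OF abs_ge_zero])
    then show "cmod (complex_of_real (a i) * u i k * cnj (u i l)) \<le> T" by (simp add: norm_mult mult.assoc)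
  qed
  finally show ?thesis by simp
qed

lemma lam_spec:
  assumes "spec_decomp (m * p) (bcirc_entry m p A) a u"
  shows "lam_max m p A = Max (a ` {..<m * p})" "lam_min m p A = Min (a ` {..<m * p})"
  using spec_eigenvalue[OF assms bcirc_eq_entries] by (simp_all add: lam_max_def lam_min_def)

text \<open>The quadratic form at the eigenvector \<open>u i\<close> equals
  \<open>a i\<close>.\<close>

lemma psd_spec:
  assumes "spec_decomp (m * p) (bcirc_entry m p A) a u" "t_le m p t_zero A" "i < m * p"
  shows "0 \<le> a i"
proof -
  let ?d = "m * p" let ?v = "vec ?d (u i)"
  have psd: "psd_mat (bcirc m m p A)" using assms(2) by (simp add: t_le_def t_zero_def)
  have dim: "dim_row (bcirc m m p A) = ?d" by (simp add: bcirc_def)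
  have "?v \<in> carrier_vec ?d" by simp
  then have "0 \<le> conjugate ?v \<bullet> (bcirc m m p A *\<^sub>v ?v)"
    using psd dim unfolding psd_mat_def by metis
  also have "conjugate ?v \<bullet> (bcirc m m p A *\<^sub>v ?v) = sesq ?d (bcirc_entry m p A) (u i) (u i)"
    by (simp add: bcirc_eq_entries sesq_ip ip_def scalar_prod_def atLeast0LessThan)
  also have "\<dots> = (\<Sum>j<?d. if j = i then complex_of_real (a j) else 0)"
    unfolding spec_sesq[OF assms(1)] using assms(1,3) by (intro sum.cong refl) (auto simp: spec_decomp_def onb_def)
  finally show ?thesis using assms(3) by (simp add: less_eq_complex_def)
qed


section \<open>The Chernoff bounds\<close>

lemma (in prob_space) bounded_tensor_AE:
  assumes mp: "m \<ge> 1" "p \<ge> 1" and T: "T > 0"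
    and herm: "\<And>\<omega>. \<omega> \<in> space M \<Longrightarrow> t_hermitian m p (X \<omega>)"
    and psd: "AE \<omega> in M. t_le m p t_zero (X \<omega>)"
    and bnd: "AE \<omega> in M. lam_max m p (X \<omega>) \<le> T"
  shows "AE \<omega> in M. \<exists>a u. spec_decomp (m * p) (bcirc_entry m p (X \<omega>)) a u \<and> (\<forall>i<m * p. 0 \<le> a i \<and> a i \<le> T)"
  using psd bnd AE_space
proof eventually_elim
  fix \<omega> assume 1: "t_le m p t_zero (X \<omega>)" "lam_max m p (X \<omega>) \<le> T" "\<omega> \<in> space M"
  obtain a u where a: "spec_decomp (m * p) (bcirc_entry m p (X \<omega>)) a u"
    using spectral bcirc_entry_hermitian_on[OF mp herm[OF 1(3)]] by blast
  have "a i \<le> T" if "i < m * p" for i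
  proof -
    have "a i \<le> Max (a ` {..<m * p})" using that by (intro Max_ge) auto
    then show ?thesis using 1(2) lam_spec(1)[OF a] by simp
  qed
  then show "\<exists>a u. spec_decomp (m * p) (bcirc_entry m p (X \<omega>)) a u \<and> (\<forall>i<m * p. 0 \<le> a i \<and> a i \<le> T)"
    using a psd_spec[OF a 1(1)] by blast
qed

lemma bcirc_entry_sum: "bcirc_entry m p (\<lambda>x. \<Sum>i\<in>I. A i x) k l = (\<Sum>i\<in>I. bcirc_entry m p (A i) k l)"
  by (simp add: bcirc_entry_def)

lemma (in prob_space) bcirc_entry_expect: "bcirc_entry m p (t_expect M X) k l = expectation (\<lambda>\<omega>. bcirc_entry m p (X \<omega>) k l)"
  by (simp add: bcirc_entry_def t_expect_def)

text \<open>The rescaled matrices have eigenvalues in [0, 1], hence the factors \<open>s / T\<close>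
  and \<open>(exp s - 1) / T\<close>. The other two conclusions serve Markov's inequality and the
  diagonalization of the mean.\<close>

lemma (in prob_space) laplace_transform_bound:
  fixes X :: "nat \<Rightarrow> 'a \<Rightarrow> tensor"
  assumes mp: "m \<ge> 1" "p \<ge> 1" and n: "n \<ge> 1" and T: "T > 0"
    and indep: "indep_vars (\<lambda>_. Pi\<^sub>M (tensor_idx m m p) (\<lambda>_. borel))
                  (\<lambda>i \<omega>. restrict (X i \<omega>) (tensor_idx m m p)) {..<n}"
    and hyps: "\<forall>i<n. (\<forall>\<omega>\<in>space M. t_hermitian m p (X i \<omega>)) \<and>
      (AE \<omega> in M. t_le m p t_zero (X i \<omega>)) \<and> (AE \<omega> in M. lam_max m p (X i \<omega>) \<le> T)"
  shows "(\<integral>\<^sup>+\<omega>. ennreal (trexp (m * p) (\<lambda>k l. complex_of_real (s / T) * bcirc_entry m p (\<lambda>x. \<Sum>i<n. X i \<omega> x) k l)) \<partial>M)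
     \<le> ennreal (trexp (m * p) (\<lambda>k l. complex_of_real ((exp s - 1) / T) * bcirc_entry m p (\<lambda>x. \<Sum>i<n. t_expect M (X i) x) k l))"
    and "(\<lambda>\<omega>. trexp (m * p) (\<lambda>k l. complex_of_real (s / T) * bcirc_entry m p (\<lambda>x. \<Sum>i<n. X i \<omega> x) k l)) \<in> borel_measurable M"
    and "hermitian_on (m * p) (bcirc_entry m p (\<lambda>x. \<Sum>i<n. t_expect M (X i) x))"
proof -
  have herm: "t_hermitian m p (X i \<omega>)" if "i < n" "\<omega> \<in> space M" for i \<omega>
    using hyps that by blast
  let ?d = "m * p" and ?I = "tensor_idx m m p"
  let ?PM = "Pi\<^sub>M ?I (\<lambda>_. borel :: complex measure)"
  \<comment> \<open>Indices from \<open>n\<close> on repeat the sample 0, so that every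
    \<open>N i\<close> below is a probability measure, as \<open>product_sigma_finite\<close>
    demands.\<close>
  define R where "R i \<omega> = restrict (X (if i < n then i else 0) \<omega>) ?I" for i \<omega>
  define Z where "Z i = bcirc_entry m p (t_expect M (X i))" for i
  have rv0: "(\<lambda>\<omega>. restrict (X i \<omega>) ?I) \<in> measurable M ?PM" if "i < n" for i
    using indep that by (auto simp: indep_vars_def2)
  then have rv: "R i \<in> measurable M ?PM" for i using n by (simp add: R_def[abs_def])
  have meas: "(\<lambda>\<omega>. bcirc_entry m p (X i \<omega>) k l) \<in> borel_measurable M" if "i < n" for i k l
    using measurable_compose[OF rv0[OF that] bcirc_entry_measurable[OF mp, of k l]] by (simp add: bcirc_entry_restrict[OF mp])
  have spec_AE: "AE \<omega> in M. \<exists>a u. spec_decomp ?d (bcirc_entry m p (X i \<omega>)) a u \<and> (\<forall>i<?d. 0 \<le> a i \<and> a i \<le> T)" if "i < n" for i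
    by (rule bounded_tensor_AE[OF mp T]) (use that hyps in auto)
  have int: "integrable M (\<lambda>\<omega>. bcirc_entry m p (X i \<omega>) k l)" if "i < n" "k < ?d" "l < ?d" for i k l
  proof (rule integrable_const_bound[where B = "real ?d * T"])
    show "AE \<omega> in M. cmod (bcirc_entry m p (X i \<omega>) k l) \<le> real ?d * T"
      using spec_AE[OF that(1)]
      by eventually_elim (use spec_entry_le that in force)
  qed (rule meas[OF that(1)])
  have Z_herm: "hermitian_on ?d (Z i)" if "i < n" for i
    unfolding hermitian_on_def Z_def bcirc_entry_expect
  proof (intro allI impI)
    fix k l assume "k < ?d" "l < ?d"
    have "expectation (\<lambda>\<omega>. bcirc_entry m p (X i \<omega>) k l) = expectation (\<lambda>\<omega>. cnj (bcirc_entry m p (X i \<omega>) l k))"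
      by (intro Bochner_Integration.integral_cong refl) (rule bcirc_entry_hermitian[OF mp herm[OF that]])
    then show "expectation (\<lambda>\<omega>. bcirc_entry m p (X i \<omega>) k l) = cnj (expectation (\<lambda>\<omega>. bcirc_entry m p (X i \<omega>) l k))"
      by simp
  qed
  have Z_sum: "bcirc_entry m p (\<lambda>x. \<Sum>i<n. t_expect M (X i) x) k l = (\<Sum>i<n. Z i k l)" for k l
    by (simp add: bcirc_entry_sum Z_def)
  show "hermitian_on ?d (bcirc_entry m p (\<lambda>x. \<Sum>i<n. t_expect M (X i) x))"
  proof -
    have "bcirc_entry m p (\<lambda>x. \<Sum>i<n. t_expect M (X i) x) = (\<lambda>k l. \<Sum>i<n. Z i k l)"
      by (intro ext Z_sum)
    then show ?thesis using hermitian_on_sum[of "{..<n}" ?d Z] Z_herm by (metis lessThan_iff)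
  qed
  show "(\<lambda>\<omega>. trexp ?d (\<lambda>k l. complex_of_real (s / T) * bcirc_entry m p (\<lambda>x. \<Sum>i<n. X i \<omega> x) k l)) \<in> borel_measurable M"
    unfolding bcirc_entry_sum by (intro trexp_measurable borel_measurable_times borel_measurable_const borel_measurable_sum meas) auto
  define N where "N i = distr M ?PM (R i)" for i
  have prob_N: "prob_space (N i)" for i unfolding N_def by (rule prob_space_distr[OF rv])
  interpret N: product_sigma_finite N
    using prob_N by (simp add: product_sigma_finite_def prob_space_imp_sigma_finite)
  have bcirc_herm_R: "bcirc_herm m p (R i \<omega>) = bcirc_entry m p (X i \<omega>)" if "i < n" "\<omega> \<in> space M" for i \<omega>
  proof -
    have "bcirc_herm m p (R i \<omega>) = bcirc_herm m p (X i \<omega>)" using that by (simp add: R_def bcirc_herm_def fun_eq_iff bcirc_entry_restrict[OF mp])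
    then show ?thesis using bcirc_herm_eq[OF mp herm[OF that]] by simp
  qed
  have bcirc_herm_N: "(\<lambda>y. bcirc_herm m p y k l) \<in> borel_measurable (N i)" for i k l
    using bcirc_herm_measurable[OF mp] by (simp add: N_def)
  have step: "(\<integral>\<^sup>+y. ennreal (trexp ?d (\<lambda>k l. H k l + complex_of_real (s / T) * bcirc_herm m p y k l)) \<partial>N i)
        \<le> ennreal (trexp ?d (\<lambda>k l. H k l + complex_of_real ((exp s - 1) / T) * Z i k l))"
    if i: "i \<in> {..<n}" and H: "hermitian_on ?d H" for i H
  proof -
    have i': "i < n" using i by simp
    have "(\<integral>\<^sup>+y. ennreal (trexp ?d (\<lambda>k l. H k l + complex_of_real (s / T) * bcirc_herm m p y k l)) \<partial>N i) =
       (\<integral>\<^sup>+\<omega>. ennreal (trexp ?d (\<lambda>k l. H k l + complex_of_real (s / T) * bcirc_herm m p (R i \<omega>) k l)) \<partial>M)"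
      unfolding N_def
      by (intro nn_integral_distr rv measurable_compose[OF _ measurable_ennreal] trexp_measurable
          borel_measurable_add borel_measurable_times borel_measurable_const bcirc_herm_N[unfolded N_def])
    also have "\<dots> = (\<integral>\<^sup>+\<omega>. ennreal (trexp ?d (\<lambda>k l. H k l + complex_of_real s * (complex_of_real (1 / T) * bcirc_entry m p (X i \<omega>) k l))) \<partial>M)"
      by (intro nn_integral_cong) (simp add: bcirc_herm_R[OF i'])
    also have "\<dots> \<le> ennreal (trexp ?d (\<lambda>k l. H k l + complex_of_real (exp s - 1) * (complex_of_real (1 / T) * Z i k l)))"
    proof (rule trexp_one_step[OF H])
      show "AE \<omega> in M. \<exists>a u. spec_decomp ?d (\<lambda>k l. complex_of_real (1 / T) * bcirc_entry m p (X i \<omega>) k l) a u \<and> (\<forall>i<?d. 0 \<le> a i \<and> a i \<le> 1)"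
        using spec_AE[OF i']
      proof eventually_elim
        fix \<omega> assume "\<exists>a u. spec_decomp ?d (bcirc_entry m p (X i \<omega>)) a u \<and> (\<forall>i<?d. 0 \<le> a i \<and> a i \<le> T)"
        then obtain a u where a: "spec_decomp ?d (bcirc_entry m p (X i \<omega>)) a u" "\<forall>i<?d. 0 \<le> a i \<and> a i \<le> T" by blast
        have "\<forall>i<?d. 0 \<le> 1 / T * a i \<and> 1 / T * a i \<le> 1" using a(2) T by (simp add: field_simps)
        then show "\<exists>a u. spec_decomp ?d (\<lambda>k l. complex_of_real (1 / T) * bcirc_entry m p (X i \<omega>) k l) a u \<and> (\<forall>i<?d. 0 \<le> a i \<and> a i \<le> 1)"
          using spec_scale[OF a(1), of "1 / T"] by blast
      qed
      show "hermitian_on ?d (\<lambda>k l. complex_of_real (1 / T) * bcirc_entry m p (X i \<omega>) k l)" if "\<omega> \<in> space M" for \<omega>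
        by (intro hermitian_on_scale bcirc_entry_hermitian_on[OF mp herm[OF i' that]])
      show "integrable M (\<lambda>\<omega>. complex_of_real (1 / T) * bcirc_entry m p (X i \<omega>) k l)" if "k < ?d" "l < ?d" for k l
        by (intro integrable_mult_right int[OF i' that])
      show "complex_of_real (1 / T) * Z i k l = expectation (\<lambda>\<omega>. complex_of_real (1 / T) * bcirc_entry m p (X i \<omega>) k l)" for k l
        by (simp add: Z_def bcirc_entry_expect)
      show "hermitian_on ?d (\<lambda>k l. complex_of_real (1 / T) * Z i k l)"
        by (intro hermitian_on_scale Z_herm i')
    qed
    finally show ?thesis by simp
  qed
  have ne: "{..<n} \<noteq> {}" using n by (simp add: lessThan_empty_iff)
  have indep': "indep_vars (\<lambda>_. ?PM) R {..<n}"
    using indep by (rule indep_vars_cong[THEN iffD1, rotated -1]) (auto simp: R_def)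
  \<comment> \<open>Independence in the form needed for integrating coordinatewise: the joint law is
    the product of the marginals.\<close>
  have distr: "distr M (Pi\<^sub>M {..<n} (\<lambda>_. ?PM)) (\<lambda>\<omega>. \<lambda>i\<in>{..<n}. R i \<omega>) = Pi\<^sub>M {..<n} N"
    using indep' rv unfolding N_def by (subst (asm) indep_vars_iff_distr_eq_PiM'[OF ne]) auto
  have "(\<integral>\<^sup>+\<omega>. ennreal (trexp ?d (\<lambda>k l. complex_of_real (s / T) * bcirc_entry m p (\<lambda>x. \<Sum>i<n. X i \<omega> x) k l)) \<partial>M) =
    (\<integral>\<^sup>+\<omega>. ennreal (trexp ?d (\<lambda>k l. 0 + complex_of_real (s / T) * (\<Sum>i<n. bcirc_herm m p ((\<lambda>i\<in>{..<n}. R i \<omega>) i) k l))) \<partial>M)"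
    by (intro nn_integral_cong) (simp add: bcirc_entry_sum bcirc_herm_R)
  also have "\<dots> = (\<integral>\<^sup>+x. ennreal (trexp ?d (\<lambda>k l. 0 + complex_of_real (s / T) * (\<Sum>i<n. bcirc_herm m p (x i) k l))) \<partial>Pi\<^sub>M {..<n} N)"
    unfolding distr[symmetric]
  proof (rule nn_integral_distr[symmetric])
    show "(\<lambda>\<omega>. \<lambda>i\<in>{..<n}. R i \<omega>) \<in> measurable M (Pi\<^sub>M {..<n} (\<lambda>_. ?PM))"
      by (intro measurable_restrict rv)
    have "(\<lambda>x. bcirc_herm m p (x j) k l) \<in> borel_measurable (Pi\<^sub>M {..<n} (\<lambda>_. ?PM))" if "j < n" for j k l
      using that by (intro measurable_compose[where f = "\<lambda>x. x j" and N = ?PM, OF measurable_component_singleton bcirc_herm_measurable[OF mp]]) auto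
    then show "(\<lambda>x. ennreal (trexp ?d (\<lambda>k l. 0 + complex_of_real (s / T) * (\<Sum>i<n. bcirc_herm m p (x i) k l)))) \<in>
        borel_measurable (distr M (Pi\<^sub>M {..<n} (\<lambda>_. ?PM)) (\<lambda>\<omega>. \<lambda>i\<in>{..<n}. R i \<omega>))"
      unfolding measurable_distr_eq1
      by (intro measurable_compose[OF _ measurable_ennreal] trexp_measurable
          borel_measurable_add borel_measurable_times borel_measurable_const borel_measurable_sum) auto
  qed
  also have "\<dots> \<le> ennreal (trexp ?d (\<lambda>k l. 0 + complex_of_real ((exp s - 1) / T) * (\<Sum>i<n. Z i k l)))"
    by (intro N.trexp_product step bcirc_herm_N bcirc_herm_hermitian hermitian_on_zero) (auto intro: Z_herm)
  finally show "(\<integral>\<^sup>+\<omega>. ennreal (trexp ?d (\<lambda>k l. complex_of_real (s / T) * bcirc_entry m p (\<lambda>x. \<Sum>i<n. X i \<omega> x) k l)) \<partial>M)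
     \<le> ennreal (trexp ?d (\<lambda>k l. complex_of_real ((exp s - 1) / T) * bcirc_entry m p (\<lambda>x. \<Sum>i<n. t_expect M (X i) x) k l))"
    by (simp add: Z_sum)
qed

text \<open>\<open>A\<close> will be an event about an extreme eigenvalue. Only the superlevel set
  of \<open>f\<close> has to be measurable, so measurability of \<open>lam_max\<close> and
  \<open>lam_min\<close> is never at issue.\<close>

lemma (in prob_space) markov_trexp:
  assumes "f \<in> borel_measurable M" "(\<integral>\<^sup>+\<omega>. ennreal (f \<omega>) \<partial>M) \<le> ennreal b" "0 \<le> b"
    and "A \<subseteq> {\<omega> \<in> space M. exp t \<le> f \<omega>}"
  shows "prob A \<le> exp (- t) * b"
proof -
  let ?B = "{\<omega> \<in> space M. exp t \<le> f \<omega>}"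
  have B: "?B \<in> events" using assms(1) by measurable
  have "emeasure M {\<omega> \<in> space M. 1 \<le> ennreal (exp (- t)) * ennreal (f \<omega>)} \<le>
      ennreal (exp (- t)) * (\<integral>\<^sup>+\<omega>. ennreal (f \<omega>) * indicator (space M) \<omega> \<partial>M)"
    using assms(1) by (intro nn_integral_Markov_inequality) auto
  also have "(\<integral>\<^sup>+\<omega>. ennreal (f \<omega>) * indicator (space M) \<omega> \<partial>M) = (\<integral>\<^sup>+\<omega>. ennreal (f \<omega>) \<partial>M)"
    by (intro nn_integral_cong) simp
  also have "ennreal (exp (- t)) * \<dots> \<le> ennreal (exp (- t)) * ennreal b"
    by (intro mult_left_mono assms) simp
  also have "\<dots> = ennreal (exp (- t) * b)" by (simp add: ennreal_mult' )
  also have "{\<omega> \<in> space M. 1 \<le> ennreal (exp (- t)) * ennreal (f \<omega>)} = ?B"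
  proof (intro Collect_cong conj_cong refl)
    fix \<omega>
    have "1 \<le> ennreal (exp (- t)) * ennreal (f \<omega>) \<longleftrightarrow> 1 \<le> exp (- t) * f \<omega>"
      by (simp add: ennreal_mult'[symmetric] ennreal_1[symmetric] ennreal_le_iff2 del: ennreal_1) auto
    also have "\<dots> \<longleftrightarrow> exp t \<le> f \<omega>" by (simp add: exp_minus field_simps)
    finally show "1 \<le> ennreal (exp (- t)) * ennreal (f \<omega>) \<longleftrightarrow> exp t \<le> f \<omega>" .
  qed
  finally have "prob ?B \<le> exp (- t) * b"
    using assms(3) by (simp add: emeasure_eq_measure ennreal_le_iff)
  moreover have "prob A \<le> prob ?B" by (rule finite_measure_mono[OF assms(4) B])
  ultimately show ?thesis by simp
qed

text \<open>The source of the dimension factor \<open>m * p\<close>: each of the \<open>d\<close>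
  exponentials is replaced by the largest admissible one.\<close>

lemma trexp_scale_le:
  assumes "spec_decomp d A a u" "\<And>i. i < d \<Longrightarrow> c * a i \<le> b"
  shows "trexp d (\<lambda>k l. complex_of_real c * A k l) \<le> real d * exp b"
proof -
  have "trexp d (\<lambda>k l. complex_of_real c * A k l) = (\<Sum>i<d. exp (c * a i))"
    by (rule trexp_eq[OF spec_scale[OF assms(1)]])
  also have "\<dots> \<le> (\<Sum>i<d. exp b)" using assms(2) by (intro sum_mono) auto
  finally show ?thesis by simp
qed

lemma le_trexp_scale:
  assumes "spec_decomp d A a u" "i < d" "b \<le> c * a i"
  shows "exp b \<le> trexp d (\<lambda>k l. complex_of_real c * A k l)"
proof -
  have "exp b \<le> exp (c * a i)" using assms(3) by simp
  also have "\<dots> \<le> (\<Sum>i<d. exp (c * a i))" using assms(2) by (intro member_le_sum) auto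
  finally show ?thesis by (simp add: trexp_eq[OF spec_scale[OF assms(1)]])
qed

theorem theorem4:
  fixes M :: "'a measure" and X :: "nat \<Rightarrow> 'a \<Rightarrow> tensor"
    and m p n :: nat and T :: real
  assumes "prob_space M"
    and "m \<ge> 1" and "p \<ge> 1" and "n \<ge> 1" and "T > 0"
    and indep: "prob_space.indep_vars M (\<lambda>_. Pi\<^sub>M (tensor_idx m m p) (\<lambda>_. borel))
                  (\<lambda>i \<omega>. restrict (X i \<omega>) (tensor_idx m m p)) {..<n}"
    and herm: "\<And>i \<omega>. i < n \<Longrightarrow> \<omega> \<in> space M \<Longrightarrow> t_hermitian m p (X i \<omega>)"
    and psd: "\<And>i. i < n \<Longrightarrow> AE \<omega> in M. t_le m p t_zero (X i \<omega>)"
    and bnd: "\<And>i. i < n \<Longrightarrow> AE \<omega> in M. lam_max m p (X i \<omega>) \<le> T"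
  defines "\<mu>max \<equiv> lam_max m p (\<lambda>x. \<Sum>i<n. t_expect M (X i) x)"
    and "\<mu>min \<equiv> lam_min m p (\<lambda>x. \<Sum>i<n. t_expect M (X i) x)"
  shows "(\<forall>\<theta>::real. \<theta> \<ge> 0 \<longrightarrow>
           measure M {\<omega> \<in> space M. lam_max m p (\<lambda>x. \<Sum>i<n. X i \<omega> x) \<ge> (1 + \<theta>) * \<mu>max}
             \<le> real (m * p) * (exp \<theta> / rpow (1 + \<theta>) (1 + \<theta>)) powr (\<mu>max / T)) \<and>
         (\<forall>\<theta>::real. 0 \<le> \<theta> \<and> \<theta> \<le> 1 \<longrightarrow>
           measure M {\<omega> \<in> space M. lam_min m p (\<lambda>x. \<Sum>i<n. X i \<omega> x) \<le> (1 - \<theta>) * \<mu>min}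
             \<le> real (m * p) * (exp (- \<theta>) / rpow (1 - \<theta>) (1 - \<theta>)) powr (\<mu>min / T))"
proof -
  interpret prob_space M by fact
  note mp = \<open>m \<ge> 1\<close> \<open>p \<ge> 1\<close>
  let ?d = "m * p"
  have ne: "b ` {..<?d} \<noteq> {}" for b :: "nat \<Rightarrow> real" using mp by (simp add: lessThan_empty_iff)
  let ?S = "\<lambda>\<omega>. bcirc_entry m p (\<lambda>x. \<Sum>i<n. X i \<omega> x)"
  let ?E = "bcirc_entry m p (\<lambda>x. \<Sum>i<n. t_expect M (X i) x)"
  have "\<forall>i<n. (\<forall>\<omega>\<in>space M. t_hermitian m p (X i \<omega>)) \<and>
      (AE \<omega> in M. t_le m p t_zero (X i \<omega>)) \<and> (AE \<omega> in M. lam_max m p (X i \<omega>) \<le> T)"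
    using herm psd bnd by blast
  note laplace = laplace_transform_bound[OF mp \<open>n \<ge> 1\<close> \<open>T > 0\<close> indep this]
  obtain a u where a: "spec_decomp ?d ?E a u" using spectral[OF laplace(3)] by blast
  have a_max: "a i \<le> \<mu>max" and a_min: "\<mu>min \<le> a i" if "i < ?d" for i
    using that unfolding \<mu>max_def \<mu>min_def lam_spec[OF a] by (auto intro: Max_ge Min_le)
  have S: "hermitian_on ?d (?S \<omega>)" if "\<omega> \<in> space M" for \<omega>
  proof -
    have "?S \<omega> = (\<lambda>k l. \<Sum>i<n. bcirc_entry m p (X i \<omega>) k l)" by (intro ext bcirc_entry_sum)
    then show ?thesis using that by (auto intro!: hermitian_on_sum bcirc_entry_hermitian_on[OF mp] herm)
  qed
  have core: "prob A \<le> exp (- t) * (real ?d * exp b)"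
    if A: "A \<subseteq> {\<omega> \<in> space M. exp t \<le> trexp ?d (\<lambda>k l. complex_of_real (s / T) * ?S \<omega> k l)}"
      and b: "\<And>i. i < ?d \<Longrightarrow> (exp s - 1) / T * a i \<le> b" for A t s b
  proof -
    have "prob A \<le> exp (- t) * trexp ?d (\<lambda>k l. complex_of_real ((exp s - 1) / T) * ?E k l)"
      by (rule markov_trexp[OF laplace(2,1) _ A]) (intro trexp_nonneg hermitian_on_scale laplace(3))
    also have "\<dots> \<le> exp (- t) * (real ?d * exp b)"
      by (intro mult_left_mono trexp_scale_le[OF a b]) auto
    finally show ?thesis .
  qed
  have upper: "prob {\<omega> \<in> space M. lam_max m p (\<lambda>x. \<Sum>i<n. X i \<omega> x) \<ge> y} \<le> exp (- (s / T * y)) * (real ?d * exp ((exp s - 1) / T * \<mu>max))"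
    if s: "s \<ge> 0" for s y
  proof (rule core[of _ _ s], safe)
    fix \<omega> assume \<omega>: "\<omega> \<in> space M" "y \<le> lam_max m p (\<lambda>x. \<Sum>i<n. X i \<omega> x)"
    obtain b w where b: "spec_decomp ?d (?S \<omega>) b w" using spectral[OF S[OF \<omega>(1)]] by blast
    have "lam_max m p (\<lambda>x. \<Sum>i<n. X i \<omega> x) \<in> b ` {..<?d}"
      unfolding lam_spec[OF b] by (intro Max_in ne) auto
    then obtain i where "i < ?d" "y \<le> b i" using \<omega>(2) by auto
    then show "exp (s / T * y) \<le> trexp ?d (\<lambda>k l. complex_of_real (s / T) * ?S \<omega> k l)"
      using s \<open>T > 0\<close> by (intro le_trexp_scale[OF b] mult_left_mono) auto
  next
    show "(exp s - 1) / T * a i \<le> (exp s - 1) / T * \<mu>max" if "i < ?d" for i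
      using s \<open>T > 0\<close> a_max[OF that] by (intro mult_left_mono) auto
  qed
  \<comment> \<open>For s <= 0 both comparisons turn around: a small eigenvalue of the sum makes the
    exponent large, and the nonpositive factor \<open>(exp s - 1) / T\<close> makes the smallest
    eigenvalue of the mean dominate.\<close>
  have lower: "prob {\<omega> \<in> space M. lam_min m p (\<lambda>x. \<Sum>i<n. X i \<omega> x) \<le> y} \<le> exp (- (s / T * y)) * (real ?d * exp ((exp s - 1) / T * \<mu>min))"
    if s: "s \<le> 0" for s y
  proof (rule core[of _ _ s], safe)
    fix \<omega> assume \<omega>: "\<omega> \<in> space M" "lam_min m p (\<lambda>x. \<Sum>i<n. X i \<omega> x) \<le> y"
    obtain b w where b: "spec_decomp ?d (?S \<omega>) b w" using spectral[OF S[OF \<omega>(1)]] by blast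
    have "lam_min m p (\<lambda>x. \<Sum>i<n. X i \<omega> x) \<in> b ` {..<?d}"
      unfolding lam_spec[OF b] by (intro Min_in ne) auto
    then obtain i where "i < ?d" "b i \<le> y" using \<omega>(2) by auto
    then show "exp (s / T * y) \<le> trexp ?d (\<lambda>k l. complex_of_real (s / T) * ?S \<omega> k l)"
      using s \<open>T > 0\<close> by (intro le_trexp_scale[OF b] mult_left_mono_neg) (auto simp: divide_nonpos_pos)
  next
    show "(exp s - 1) / T * a i \<le> (exp s - 1) / T * \<mu>min" if "i < ?d" for i
      using s \<open>T > 0\<close> a_min[OF that] by (intro mult_left_mono_neg) (auto simp: divide_nonpos_pos)
  qed
  \<comment> \<open>Here s = ln z and the threshold is \<open>z * \<mu>\<close>, with z = 1 + theta
    or 1 - theta. For positive \<open>\<mu>\<close> this s minimizes the exponent (e^s - 1)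
    \<open>\<mu>\<close> - s z \<open>\<mu>\<close>.\<close>
  have closed_form: "exp (- (ln z / T * (z * \<mu>))) * (real ?d * exp ((exp (ln z) - 1) / T * \<mu>)) =
      real ?d * (exp (z - 1) / rpow z z) powr (\<mu> / T)" if z: "z > 0" for z \<mu>
  proof -
    have "ln (exp (z - 1) / rpow z z) = (z - 1) - z * ln z"
      using z by (simp add: rpow_def ln_div)
    then have "(exp (z - 1) / rpow z z) powr (\<mu> / T) = exp (\<mu> / T * ((z - 1) - z * ln z))"
      using z by (simp add: powr_def rpow_def)
    also have "\<dots> = exp (- (ln z / T * (z * \<mu>))) * exp ((z - 1) / T * \<mu>)"
      using \<open>T > 0\<close> unfolding exp_add[symmetric] by (simp add: divide_simps) (simp add: algebra_simps)
    finally show ?thesis using z by simp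
  qed
  show ?thesis
  proof (intro conjI allI impI)
    fix \<theta> :: real assume "\<theta> \<ge> 0"
    then have pos: "1 + \<theta> > 0" by simp
    from \<open>\<theta> \<ge> 0\<close> show "prob {\<omega> \<in> space M. lam_max m p (\<lambda>x. \<Sum>i<n. X i \<omega> x) \<ge> (1 + \<theta>) * \<mu>max}
      \<le> real ?d * (exp \<theta> / rpow (1 + \<theta>) (1 + \<theta>)) powr (\<mu>max / T)"
      using upper[of "ln (1 + \<theta>)" "(1 + \<theta>) * \<mu>max", unfolded closed_form[OF pos]] by simp
  next
    fix \<theta> :: real assume \<theta>: "0 \<le> \<theta> \<and> \<theta> \<le> 1"
    show "prob {\<omega> \<in> space M. lam_min m p (\<lambda>x. \<Sum>i<n. X i \<omega> x) \<le> (1 - \<theta>) * \<mu>min}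
      \<le> real ?d * (exp (- \<theta>) / rpow (1 - \<theta>) (1 - \<theta>)) powr (\<mu>min / T)"
    proof (cases "\<theta> = 1")
      case False
      then have pos: "1 - \<theta> > 0" using \<theta> by simp
      then show ?thesis
        using \<theta> lower[of "ln (1 - \<theta>)" "(1 - \<theta>) * \<mu>min", unfolded closed_form[OF pos]] by simp
    next
      case True
      \<comment> \<open>The threshold is 0, so the Markov factor equals 1 for every s and s may tend
        to minus infinity. The limit exp (-\<open>\<mu>min\<close> / T) is the claimed bound by the
        convention \<open>rpow 0 0 = 1\<close>.\<close>
      let ?P = "prob {\<omega> \<in> space M. lam_min m p (\<lambda>x. \<Sum>i<n. X i \<omega> x) \<le> 0}"
      have "((\<lambda>s. real ?d * exp ((exp s - 1) / T * \<mu>min)) \<longlongrightarrow> real ?d * exp ((0 - 1) / T * \<mu>min)) at_bot"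
        using \<open>T > 0\<close> by (intro tendsto_intros exp_at_bot) auto
      moreover have "eventually (\<lambda>s. ?P \<le> real ?d * exp ((exp s - 1) / T * \<mu>min)) at_bot"
        using eventually_le_at_bot[of 0] by eventually_elim (use lower[of _ 0] in simp)
      ultimately have "?P \<le> real ?d * exp ((0 - 1) / T * \<mu>min)"
        by (intro tendsto_lowerbound) auto
      then show ?thesis using True by (simp add: rpow_def powr_def)
    qed
  qed
qed

end
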